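(* Let $k \geq 2$ be an integer. There exist a constant $C = C(k) > 0$ and infinitely many positive integers $N$ such that the number of $k$-dimensional corner-free subsets of $\{1,2,\dots,N\}^k$ is at most $2^{C \cdot c_k(N)}$; that is, the number of such subsets is $2^{O(c_k(N))}$ for infinitely many values of $N$.
   Context: For a positive integer $N$ write $[N]=\{1,2,\dots,N\}$. A $k$-dimensional corner in $[N]^k$ is a set of points of the form $\{\mathbf{a}\}\cup\{\mathbf{a}+de_i : 1\le i\le k\}$ contained in $[N]^k$, for some $\mathbf{a}\in[N]^k$ and integer $d>0$, where $e_1,\dots,e_k$ is the standard basis of $\mathbb{R}^k$. A subset of $[N]^k$ is $k$-dimensional corner-free if it contains no $k$-dimensional corner. $c_k(N)$ denotes the maximum size of a $k$-dimensional corner-free subset of $[N]^k$. *)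

theory Defs
  imports Complex_Main "HOL-Library.FuncSet"
begin

text \<open>Points of \<open>[N]^k\<close> are functions on \<open>{1..k}\<close>, taken extensional (value
  \<open>undefined\<close> outside \<open>{1..k}\<close>) so that distinct points are distinct functions.\<close>

definition grid :: "nat \<Rightarrow> nat \<Rightarrow> (nat \<Rightarrow> nat) set" where
  "grid k N = ({1..k} \<rightarrow>\<^sub>E {1..N})"

definition corner :: "nat \<Rightarrow> (nat \<Rightarrow> nat) \<Rightarrow> nat \<Rightarrow> (nat \<Rightarrow> nat) set" where
  "corner k a d = {a} \<union> {a(i := a i + d) | i. i \<in> {1..k}}"

definition is_corner :: "nat \<Rightarrow> nat \<Rightarrow> (nat \<Rightarrow> nat) set \<Rightarrow> bool" where
  "is_corner k N S \<longleftrightarrow> (\<exists>a\<in>grid k N. \<exists>d>0. S = corner k a d \<and> S \<subseteq> grid k N)"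

definition corner_free :: "nat \<Rightarrow> nat \<Rightarrow> (nat \<Rightarrow> nat) set \<Rightarrow> bool" where
  "corner_free k N A \<longleftrightarrow> A \<subseteq> grid k N \<and> \<not> (\<exists>S. is_corner k N S \<and> S \<subseteq> A)"

definition max_corner_free :: "nat \<Rightarrow> nat \<Rightarrow> nat" where
  "max_corner_free k N = Max {card A | A. corner_free k N A}"

lemma finite_grid: "finite (grid k N)"
  unfolding grid_def by (intro finite_PiE) auto

lemma finite_corner_free: "finite {A. corner_free k N A}"
  by (rule finite_subset[of _ "Pow (grid k N)"]) (auto simp: corner_free_def finite_grid)

lemma corner_free_empty: "corner_free k N {}"
  by (auto simp: corner_free_def is_corner_def corner_def)

end

theory Submission
  imports Defs "HOL-Computational_Algebra.Primes"
begin

text \<open>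
  Write \<open>\<delta>(N) = c\<^sub>k(N) / N^k\<close>.  Behrend's construction gives \<open>\<delta>(2^(u^2)) \<ge> 2^(-7u)\<close>, so along the
  sequence \<open>N\<^sub>t = 2^((ht)^2)\<close> the density \<open>\<delta>\<close> cannot drop by more than a fixed factor at almost every
  step: infinitely often \<open>\<delta>(M) = O(\<delta>(N))\<close> with \<open>M = N\<^sub>t\<close>, \<open>N = N\<^sub>t\<^sub>+\<^sub>1\<close>.  For such \<open>N\<close>, splitting
  \<open>[N]^k\<close> into copies of \<open>[M]^k\<close> dilated by a prime \<open>p \<le> N/M\<close> shows that a set \<open>A\<close> larger than a
  constant times \<open>c\<^sub>k(N)\<close> contains about \<open>|A|\<close> corners with difference divisible by \<open>p\<close>.  A
  difference has at most \<open>log N\<close> prime divisors, so \<open>A\<close> contains almost \<open>|A| N/M\<close> corners, and \<open>N/M\<close>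
  exceeds any fixed power of \<open>1/\<delta>(N)\<close> once \<open>h\<close> is large.

  Two points lie in boundedly many common corners.  Hence a hypergraph container argument applies:
  every large \<open>A\<close> has few subsets, each a positive proportion of \<open>A\<close>, such that every corner-free
  subset of \<open>A\<close> misses one of them.  Iterating down to sets of size \<open>O(c\<^sub>k(N))\<close> costs a factor
  \<open>2^O(c\<^sub>k(N))\<close> in the number of corner-free sets.
\<close>

section \<open>Containers for hypergraphs with bounded codegrees\<close>

text \<open>Edges are indexed by \<open>J\<close> and \<open>\<phi>\<close> need not be injective:
  edges that become equal after losing vertices still count separately.\<close>

definition bounded_hypergraph ::
    "nat \<Rightarrow> real \<Rightarrow> real \<Rightarrow> 'a set \<Rightarrow> 'i set \<Rightarrow> ('i \<Rightarrow> 'a set) \<Rightarrow> bool" where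
  "bounded_hypergraph r D B A J \<phi> \<longleftrightarrow>
     finite A \<and> finite J \<and> (\<forall>i\<in>J. \<phi> i \<subseteq> A \<and> card (\<phi> i) = r) \<and>
     (\<forall>v. real (card {i \<in> J. v \<in> \<phi> i}) \<le> D) \<and>
     (\<forall>u v. u \<noteq> v \<longrightarrow> real (card {i \<in> J. u \<in> \<phi> i \<and> v \<in> \<phi> i}) \<le> B)"

lemma sum_degrees:
  assumes "finite A" "finite J" "\<And>i. i \<in> J \<Longrightarrow> \<phi> i \<subseteq> A"
  shows "(\<Sum>v\<in>A. card {i \<in> J. v \<in> \<phi> i}) = (\<Sum>i\<in>J. card (\<phi> i))"
proof (rule sum_multicount_gen[OF assms(1,2)])
  show "\<forall>i\<in>J. card {v \<in> A. v \<in> \<phi> i} = card (\<phi> i)"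
    by (intro ballI arg_cong[where f = card]) (use assms(3) in blast)
qed

lemma card_incident_le:
  assumes "finite X" "finite J" "\<And>v. real (card {i \<in> J. v \<in> \<phi> i}) \<le> D"
  shows "real (card {i \<in> J. \<exists>v\<in>X. v \<in> \<phi> i}) \<le> real (card X) * D"
proof -
  have "card {i \<in> J. \<exists>v\<in>X. v \<in> \<phi> i} = card (\<Union>v\<in>X. {i \<in> J. v \<in> \<phi> i})"
    by (rule arg_cong[where f = card]) auto
  also have "\<dots> \<le> (\<Sum>v\<in>X. card {i \<in> J. v \<in> \<phi> i})"
    by (rule card_UN_le[OF assms(1)])
  finally have "real (card {i \<in> J. \<exists>v\<in>X. v \<in> \<phi> i}) \<le> (\<Sum>v\<in>X. real (card {i \<in> J. v \<in> \<phi> i}))"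
    unfolding of_nat_sum[symmetric] of_nat_le_iff .
  also have "\<dots> \<le> real (card X) * D"
    by (rule sum_bounded_above) (rule assms(3))
  finally show ?thesis .
qed

text \<open>
  A state \<open>\<sigma>\<close> records which edges have been used: \<open>\<sigma> i = Some v\<close> means that edge \<open>i\<close> is replaced by
  \<open>\<phi> i - {v}\<close>, where \<open>v\<close> is known to lie in the independent set.  Querying \<open>v\<close> uses all unused edges
  through \<open>v\<close> without a vertex of residual degree at least \<open>\<Delta>\<close>; only queries that use at least \<open>\<theta>\<close>
  edges are made.
\<close>
definition residual_degree :: "('i \<Rightarrow> 'a set) \<Rightarrow> ('i \<rightharpoonup> 'a) \<Rightarrow> 'a \<Rightarrow> nat" where
  "residual_degree \<phi> \<sigma> u = card {i \<in> dom \<sigma>. u \<in> \<phi> i \<and> \<sigma> i \<noteq> Some u}"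

definition gain :: "'i set \<Rightarrow> ('i \<Rightarrow> 'a set) \<Rightarrow> real \<Rightarrow> ('i \<rightharpoonup> 'a) \<Rightarrow> 'a \<Rightarrow> 'i set" where
  "gain J \<phi> \<Delta> \<sigma> v =
     {i \<in> J - dom \<sigma>. v \<in> \<phi> i \<and> (\<forall>u\<in>\<phi> i. real (residual_degree \<phi> \<sigma> u) < \<Delta>)}"

definition query :: "'i set \<Rightarrow> ('i \<Rightarrow> 'a set) \<Rightarrow> real \<Rightarrow> ('i \<rightharpoonup> 'a) \<Rightarrow> 'a \<Rightarrow> ('i \<rightharpoonup> 'a)" where
  "query J \<phi> \<Delta> \<sigma> v = (\<lambda>i. if i \<in> gain J \<phi> \<Delta> \<sigma> v then Some v else \<sigma> i)"

primrec states ::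
    "'i set \<Rightarrow> ('i \<Rightarrow> 'a set) \<Rightarrow> real \<Rightarrow> real \<Rightarrow> 'a set \<Rightarrow> nat \<Rightarrow> ('i \<rightharpoonup> 'a) set" where
  "states J \<phi> \<Delta> \<theta> V 0 = {Map.empty}"
| "states J \<phi> \<Delta> \<theta> V (Suc l) =
     {query J \<phi> \<Delta> \<sigma> v | \<sigma> v. \<sigma> \<in> states J \<phi> \<Delta> \<theta> V l \<and> v \<in> V \<and> \<theta> \<le> real (card (gain J \<phi> \<Delta> \<sigma> v))}"

section \<open>The query process and its invariants\<close>

lemma dom_query: "dom (query J \<phi> \<Delta> \<sigma> v) = dom \<sigma> \<union> gain J \<phi> \<Delta> \<sigma> v"
  unfolding dom_def query_def by auto

text \<open>Places a run that queries only vertices of an independent set among the runs on the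
  whole vertex set, a collection that does not depend on that set.\<close>

lemma states_mono:
  assumes "V \<subseteq> W" shows "states J \<phi> \<Delta> \<theta> V l \<subseteq> states J \<phi> \<Delta> \<theta> W l"
proof (induction l)
  case (Suc l)
  show ?case
  proof
    fix \<rho> assume "\<rho> \<in> states J \<phi> \<Delta> \<theta> V (Suc l)"
    then obtain \<sigma> v where "\<rho> = query J \<phi> \<Delta> \<sigma> v" "\<sigma> \<in> states J \<phi> \<Delta> \<theta> V l" "v \<in> V"
      "\<theta> \<le> real (card (gain J \<phi> \<Delta> \<sigma> v))" by auto
    then show "\<rho> \<in> states J \<phi> \<Delta> \<theta> W (Suc l)"
      unfolding states.simps using Suc.IH assms by blast
  qed
qed auto

text \<open>A state reached by \<open>l\<close> queries is determined by the sequence of queried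
  vertices.\<close>

lemma finite_card_states:
  assumes "finite V"
  shows "finite (states J \<phi> \<Delta> \<theta> V l) \<and> card (states J \<phi> \<Delta> \<theta> V l) \<le> card V ^ l"
proof (induction l)
  case (Suc l)
  have sub: "states J \<phi> \<Delta> \<theta> V (Suc l)
      \<subseteq> (\<lambda>(\<sigma>, v). query J \<phi> \<Delta> \<sigma> v) ` (states J \<phi> \<Delta> \<theta> V l \<times> V)"
    by auto
  have fin: "finite (states J \<phi> \<Delta> \<theta> V l \<times> V)"
    using Suc.IH assms by auto
  have "card (states J \<phi> \<Delta> \<theta> V (Suc l)) \<le> card (states J \<phi> \<Delta> \<theta> V l \<times> V)"
    using surj_card_le[OF fin sub] .
  also have "\<dots> \<le> card V ^ Suc l"
    using Suc.IH by (simp add: card_cartesian_product mult.commute)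
  finally show ?case
    using finite_subset[OF sub finite_imageI[OF fin]] by blast
qed auto

text \<open>Greedy run: while some vertex of \<open>V\<close> gains at least \<open>\<theta>\<close>
  edges, query one, but at most \<open>s\<close> times.\<close>

lemma states_stop:
  "\<exists>l\<le>s. \<exists>\<sigma>\<in>states J \<phi> \<Delta> \<theta> V l. l = s \<or> (\<forall>v\<in>V. real (card (gain J \<phi> \<Delta> \<sigma> v)) < \<theta>)"
proof (induction s)
  case (Suc s)
  then obtain l \<sigma> where l: "l \<le> s" "\<sigma> \<in> states J \<phi> \<Delta> \<theta> V l"
    "l = s \<or> (\<forall>v\<in>V. real (card (gain J \<phi> \<Delta> \<sigma> v)) < \<theta>)" by blast
  show ?case
  proof (cases "\<forall>v\<in>V. real (card (gain J \<phi> \<Delta> \<sigma> v)) < \<theta>")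
    case True
    then show ?thesis using l le_SucI by blast
  next
    case False
    then obtain v where "v \<in> V" "\<theta> \<le> real (card (gain J \<phi> \<Delta> \<sigma> v))" by force
    then have "query J \<phi> \<Delta> \<sigma> v \<in> states J \<phi> \<Delta> \<theta> V (Suc s)"
      unfolding states.simps using l False by blast
    then show ?thesis by blast
  qed
qed auto

lemma states_assigned:
  assumes "\<sigma> \<in> states J \<phi> \<Delta> \<theta> V l"
  shows "dom \<sigma> \<subseteq> J" "\<sigma> i = Some v \<Longrightarrow> v \<in> \<phi> i \<and> v \<in> V"
proof -
  have "dom \<sigma> \<subseteq> J \<and> (\<forall>i v. \<sigma> i = Some v \<longrightarrow> v \<in> \<phi> i \<and> v \<in> V)"
    using assms
  proof (induction l arbitrary: \<sigma>)
    case (Suc l)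
    then obtain \<rho> v where \<rho>: "\<sigma> = query J \<phi> \<Delta> \<rho> v" "\<rho> \<in> states J \<phi> \<Delta> \<theta> V l" "v \<in> V" by auto
    have IH: "dom \<rho> \<subseteq> J" "\<And>i w. \<rho> i = Some w \<Longrightarrow> w \<in> \<phi> i \<and> w \<in> V"
      using Suc.IH[OF \<rho>(2)] by auto
    have gain: "gain J \<phi> \<Delta> \<rho> v \<subseteq> {i \<in> J. v \<in> \<phi> i}" by (auto simp: gain_def)
    have "w \<in> \<phi> i \<and> w \<in> V" if "\<sigma> i = Some w" for i w
    proof (cases "i \<in> gain J \<phi> \<Delta> \<rho> v")
      case True
      then show ?thesis using that gain \<rho>(3) by (auto simp: \<rho>(1) query_def)
    next
      case False
      then show ?thesis using that IH(2) by (simp add: \<rho>(1) query_def)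
    qed
    moreover have "dom \<sigma> \<subseteq> J"
      unfolding \<rho>(1) dom_query using IH(1) gain by blast
    ultimately show ?case by blast
  qed auto
  then show "dom \<sigma> \<subseteq> J" "\<sigma> i = Some v \<Longrightarrow> v \<in> \<phi> i \<and> v \<in> V" by auto
qed

lemma states_card_dom:
  assumes "bounded_hypergraph r D B A J \<phi>" "\<sigma> \<in> states J \<phi> \<Delta> \<theta> V l"
  shows "real l * \<theta> \<le> real (card (dom \<sigma>))" "real (card (dom \<sigma>)) \<le> real l * D"
proof -
  have finJ: "finite J" and deg: "\<And>v. real (card {i \<in> J. v \<in> \<phi> i}) \<le> D"
    using assms(1) by (auto simp: bounded_hypergraph_def)
  have "real l * \<theta> \<le> real (card (dom \<sigma>)) \<and> real (card (dom \<sigma>)) \<le> real l * D"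
    using assms(2)
  proof (induction l arbitrary: \<sigma>)
    case (Suc l)
    then obtain \<rho> v where \<rho>: "\<sigma> = query J \<phi> \<Delta> \<rho> v" "\<rho> \<in> states J \<phi> \<Delta> \<theta> V l"
      "\<theta> \<le> real (card (gain J \<phi> \<Delta> \<rho> v))" by auto
    have fin: "finite (dom \<rho>)" "finite (gain J \<phi> \<Delta> \<rho> v)"
      using states_assigned(1)[OF \<rho>(2)] finJ by (auto simp: gain_def intro: finite_subset)
    have "card (dom \<sigma>) = card (dom \<rho>) + card (gain J \<phi> \<Delta> \<rho> v)"
      unfolding \<rho>(1) dom_query by (rule card_Un_disjoint[OF fin]) (auto simp: gain_def)
    moreover have "card (gain J \<phi> \<Delta> \<rho> v) \<le> card {i \<in> J. v \<in> \<phi> i}"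
      by (rule card_mono) (use finJ in \<open>auto simp: gain_def\<close>)
    ultimately show ?case
      using Suc.IH[OF \<rho>(2)] \<rho>(3) deg[of v] by (simp add: algebra_simps)
  qed auto
  then show "real l * \<theta> \<le> real (card (dom \<sigma>))" "real (card (dom \<sigma>)) \<le> real l * D" by auto
qed

text \<open>A query of \<open>v\<close> raises the residual degree of another vertex
  \<open>u\<close> only through edges containing both, at most \<open>B\<close> of them, and only if
  that degree was still below \<open>\<Delta>\<close>.\<close>

lemma states_residual_degree:
  assumes "bounded_hypergraph r D B A J \<phi>" "\<sigma> \<in> states J \<phi> \<Delta> \<theta> V l" "0 \<le> \<Delta>" "0 \<le> B"
  shows "real (residual_degree \<phi> \<sigma> u) \<le> \<Delta> + B"
  using assms(2)
proof (induction l arbitrary: \<sigma>)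
  case 0
  then show ?case using assms(3,4) by (simp add: residual_degree_def)
next
  case (Suc l)
  have finJ: "finite J"
    and codeg: "\<And>u v. u \<noteq> v \<Longrightarrow> real (card {i \<in> J. u \<in> \<phi> i \<and> v \<in> \<phi> i}) \<le> B"
    using assms(1) by (auto simp: bounded_hypergraph_def)
  from Suc.prems obtain \<rho> v where \<rho>: "\<sigma> = query J \<phi> \<Delta> \<rho> v" "\<rho> \<in> states J \<phi> \<Delta> \<theta> V l"
    "\<theta> \<le> real (card (gain J \<phi> \<Delta> \<rho> v))" by auto
  have fin: "finite (dom \<rho>)"
    using states_assigned(1)[OF \<rho>(2)] finJ by (auto intro: finite_subset)
  let ?old = "{i \<in> dom \<rho>. u \<in> \<phi> i \<and> \<rho> i \<noteq> Some u}"
  let ?new = "{i \<in> gain J \<phi> \<Delta> \<rho> v. u \<in> \<phi> i \<and> u \<noteq> v}"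
  have split: "{i \<in> dom \<sigma>. u \<in> \<phi> i \<and> \<sigma> i \<noteq> Some u} \<subseteq> ?old \<union> ?new"
    by (auto simp: \<rho>(1) query_def split: if_splits)
  have finn: "finite (?old \<union> ?new)"
    using fin finJ by (auto simp: gain_def)
  have le: "residual_degree \<phi> \<sigma> u \<le> residual_degree \<phi> \<rho> u + card ?new"
    using card_mono[OF finn split] card_Un_le[of ?old ?new]
    by (simp add: residual_degree_def)
  show ?case
  proof (cases "?new = {}")
    case True
    then show ?thesis using le Suc.IH[OF \<rho>(2)] by (simp add: True)
  next
    case False
    then have "u \<noteq> v" "real (residual_degree \<phi> \<rho> u) < \<Delta>"
      by (auto simp: gain_def)
    moreover have "card ?new \<le> card {i \<in> J. u \<in> \<phi> i \<and> v \<in> \<phi> i}"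
      by (rule card_mono) (use finJ in \<open>auto simp: gain_def\<close>)
    ultimately show ?thesis using codeg[of u v] le by linarith
  qed
qed

lemma bounded_hypergraph_mono:
  assumes "bounded_hypergraph r D B A J \<phi>" "D \<le> D'"
  shows "bounded_hypergraph r D' B A J \<phi>"
proof -
  have "real (card {i \<in> J. v \<in> \<phi> i}) \<le> D'" for v
    using assms order_trans unfolding bounded_hypergraph_def by blast
  then show ?thesis using assms(1) unfolding bounded_hypergraph_def by simp
qed

text \<open>The queries use up at most a quarter of \<open>d * card A\<close> edges, and edges
  through vertices of residual degree at least \<open>\<Delta>\<close> account for at most another
  quarter. All other edges are available to a query, so the gains sum to at least half of
  \<open>d * card A\<close>; vertices of gain below \<open>d / 4\<close> contribute at most half of
  that, the others at most \<open>K * d\<close> each.\<close>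

lemma many_gainful_vertices:
  fixes K d \<Delta> :: real
  assumes H: "bounded_hypergraph (Suc r) (K * d) B A J \<phi>"
    and edges: "d * real (card A) \<le> real (card J)"
    and \<sigma>: "\<sigma> \<in> states J \<phi> \<Delta> \<theta> V l" and l: "l \<le> s"
    and pos: "K \<ge> 1" "d > 0" "s > 0"
    and s: "4 * K * real s \<le> real (card A)"
    and \<Delta>: "\<Delta> = 4 * real (Suc r) * K\<^sup>2 * (real s / real (card A)) * d"
  shows "real (card A) \<le> 4 * K * real (card {v \<in> A. d / 4 \<le> real (card (gain J \<phi> \<Delta> \<sigma> v))})"
proof -
  define a where "a = real (card A)"
  have "0 < 4 * K * real s" using pos by simp
  then have a: "a > 0" using s unfolding a_def by linarith
  have finA: "finite A" and finJ: "finite J"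
    and \<phi>: "\<And>i. i \<in> J \<Longrightarrow> \<phi> i \<subseteq> A" "\<And>i. i \<in> J \<Longrightarrow> card (\<phi> i) = Suc r"
    and deg: "\<And>v. real (card {i \<in> J. v \<in> \<phi> i}) \<le> K * d"
    using H by (auto simp: bounded_hypergraph_def)
  have domJ: "dom \<sigma> \<subseteq> J" by (rule states_assigned(1)[OF \<sigma>])
  then have find: "finite (dom \<sigma>)" using finJ finite_subset by blast
  have "real (card (dom \<sigma>)) \<le> real l * (K * d)"
    by (rule states_card_dom(2)[OF H \<sigma>])
  also have "\<dots> \<le> real s * (K * d)"
    using l pos by (intro mult_right_mono) auto
  finally have cd: "real (card (dom \<sigma>)) \<le> real s * (K * d)" .
  have cd': "real (card (dom \<sigma>)) \<le> d * a / 4"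
  proof -
    have "(4 * K * real s) * d \<le> real (card A) * d"
      using s pos by (intro mult_right_mono) auto
    then show ?thesis using cd by (simp add: a_def algebra_simps)
  qed
  \<comment> \<open>Saturated vertices. Their residual degrees sum to at most \<open>Suc r\<close>
    times the number of used edges; \<open>\<Delta>\<close> is chosen so that there are at most
    \<open>card A / (4 * K)\<close> of them.\<close>
  define Sat where "Sat = {u \<in> A. \<Delta> \<le> real (residual_degree \<phi> \<sigma> u)}"
  have finS: "finite Sat" using finA by (simp add: Sat_def)
  have "real (card Sat) * \<Delta> \<le> (\<Sum>u\<in>Sat. real (residual_degree \<phi> \<sigma> u))"
    by (rule sum_bounded_below) (auto simp: Sat_def)
  also have "\<dots> \<le> (\<Sum>u\<in>A. real (residual_degree \<phi> \<sigma> u))"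
    by (rule sum_mono2[OF finA]) (auto simp: Sat_def)
  also have "\<dots> \<le> (\<Sum>u\<in>A. real (card {i \<in> dom \<sigma>. u \<in> \<phi> i}))"
    unfolding residual_degree_def using find
    by (intro sum_mono of_nat_mono card_mono) auto
  also have "\<dots> = real (\<Sum>i\<in>dom \<sigma>. card (\<phi> i))"
    unfolding of_nat_sum[symmetric] using \<phi>(1) domJ
    by (intro arg_cong[where f = real] sum_degrees[OF finA find]) blast
  also have "\<dots> = real (Suc r) * real (card (dom \<sigma>))"
    using \<phi>(2) domJ by (subst sum.cong[of _ _ _ "\<lambda>_. Suc r"]) (auto simp: algebra_simps)
  also have "\<dots> \<le> real (Suc r) * (real s * (K * d))"
    using cd by (intro mult_left_mono) auto
  finally have "real (card Sat) * \<Delta> \<le> real (Suc r) * (real s * (K * d))" .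
  then have "(real (card Sat) * (4 * K)) * (real (Suc r) * real s * K * d)
      \<le> a * (real (Suc r) * real s * K * d)"
    using a unfolding \<Delta> a_def[symmetric] by (simp add: field_simps power2_eq_square del: of_nat_Suc)
  moreover have "real (Suc r) * real s * K * d > 0" using pos by simp
  ultimately have "real (card Sat) * (4 * K) \<le> a" by (rule mult_right_le_imp_le)
  from mult_right_mono[OF this, of d] pos
  have cS: "real (card Sat) * (K * d) \<le> d * a / 4" by (simp add: algebra_simps)
  define good where "good = {i \<in> J - dom \<sigma>. \<forall>u\<in>\<phi> i. real (residual_degree \<phi> \<sigma> u) < \<Delta>}"
  have fing: "finite good" using finJ by (simp add: good_def)
  let ?hit = "{i \<in> J. \<exists>v\<in>Sat. v \<in> \<phi> i}"
  have "J \<subseteq> good \<union> (dom \<sigma> \<union> ?hit)"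
    using \<phi>(1) by (force simp: good_def Sat_def)
  then have "card J \<le> card (good \<union> (dom \<sigma> \<union> ?hit))"
    using fing find finJ by (intro card_mono) auto
  also have "\<dots> \<le> card good + (card (dom \<sigma>) + card ?hit)"
    using card_Un_le[of good "dom \<sigma> \<union> ?hit"] card_Un_le[of "dom \<sigma>" ?hit] by linarith
  finally have "real (card J) \<le> real (card good) + (real (card (dom \<sigma>)) + real (card ?hit))"
    by linarith
  moreover have "real (card ?hit) \<le> real (card Sat) * (K * d)"
    by (rule card_incident_le[OF finS finJ deg])
  ultimately have good: "d * a / 2 \<le> real (card good)"
    using cd' cS edges unfolding a_def by linarith
  let ?g = "\<lambda>v. gain J \<phi> \<Delta> \<sigma> v"
  define Z where "Z = {v \<in> A. d / 4 \<le> real (card (?g v))}"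
  have gain: "?g v = {i \<in> good. v \<in> \<phi> i}" for v
    by (auto simp: gain_def good_def)
  have "real (card good) \<le> real (\<Sum>i\<in>good. card (\<phi> i))"
    using \<phi>(2) by (subst sum.cong[of _ _ _ "\<lambda>_. Suc r"]) (auto simp: good_def)
  also have "\<dots> = (\<Sum>v\<in>A. real (card (?g v)))"
    unfolding of_nat_sum[symmetric] gain using \<phi>(1)
    by (intro arg_cong[where f = real] sum_degrees[OF finA fing, symmetric]) (auto simp: good_def)
  also have "\<dots> \<le> (\<Sum>v\<in>A. d / 4 + (if v \<in> Z then K * d else 0))"
  proof (rule sum_mono)
    fix v assume "v \<in> A"
    have "card (?g v) \<le> card {i \<in> J. v \<in> \<phi> i}"
      using finJ by (intro card_mono) (auto simp: gain_def)
    then show "real (card (?g v)) \<le> d / 4 + (if v \<in> Z then K * d else 0)"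
      using deg[of v] \<open>v \<in> A\<close> pos by (auto simp: Z_def)
  qed
  also have "\<dots> = a * d / 4 + real (card Z) * (K * d)"
    using finA by (simp add: sum.distrib sum.If_cases a_def Z_def Int_def)
  finally have "a * d \<le> (4 * K * real (card Z)) * d"
    using good by (simp add: algebra_simps)
  then show ?thesis using pos by (simp add: a_def Z_def)
qed

lemma sum_powers_le: "(\<Sum>l\<le>s. a ^ l) \<le> (a + 1 :: nat) ^ s"
proof (induction s)
  case (Suc s)
  have "(\<Sum>l\<le>Suc s. a ^ l) = 1 + a * (\<Sum>l\<le>s. a ^ l)"
    by (simp only: sum.atMost_Suc_shift sum_distrib_left power_Suc power_0)
  also have "\<dots> \<le> (a + 1) ^ s + a * (a + 1) ^ s"
    using Suc by (intro add_mono mult_left_mono) auto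
  also have "\<dots> = (a + 1) ^ Suc s" by simp
  finally show ?case .
qed auto

text \<open>Edge \<open>i\<close> loses the vertex recorded by \<open>\<sigma>\<close>, so vertex
  degrees become the residual degrees, while the edges through a given pair can only become
  fewer.\<close>

lemma residual_hypergraph:
  assumes H: "bounded_hypergraph (Suc r) D B A J \<phi>"
    and \<sigma>: "\<sigma> \<in> states J \<phi> \<Delta> \<theta> V l" and "0 \<le> \<Delta>" "0 \<le> B"
  shows "bounded_hypergraph r (\<Delta> + B) B A (dom \<sigma>) (\<lambda>i. \<phi> i - {the (\<sigma> i)})"
  unfolding bounded_hypergraph_def
proof (intro conjI allI ballI impI)
  have finA: "finite A" and finJ: "finite J"
    and \<phi>: "\<And>i. i \<in> J \<Longrightarrow> \<phi> i \<subseteq> A" "\<And>i. i \<in> J \<Longrightarrow> card (\<phi> i) = Suc r"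
    and codeg: "\<And>u v. u \<noteq> v \<Longrightarrow> real (card {i \<in> J. u \<in> \<phi> i \<and> v \<in> \<phi> i}) \<le> B"
    using H by (auto simp: bounded_hypergraph_def)
  have domJ: "dom \<sigma> \<subseteq> J" by (rule states_assigned(1)[OF \<sigma>])
  show "finite A" by (rule finA)
  show find: "finite (dom \<sigma>)" using domJ finJ finite_subset by blast
  show "\<phi> i - {the (\<sigma> i)} \<subseteq> A" if "i \<in> dom \<sigma>" for i
    using \<phi>(1) domJ that by blast
  show "card (\<phi> i - {the (\<sigma> i)}) = r" if "i \<in> dom \<sigma>" for i
  proof -
    from that obtain v where v: "\<sigma> i = Some v" by blast
    then have "v \<in> \<phi> i" using states_assigned(2)[OF \<sigma>] by blast
    then show ?thesis using \<phi>(2)[of i] domJ that v by (auto simp: card_Diff_singleton)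
  qed
  show "real (card {i \<in> dom \<sigma>. v \<in> \<phi> i - {the (\<sigma> i)}}) \<le> \<Delta> + B" for v
  proof -
    have "{i \<in> dom \<sigma>. v \<in> \<phi> i - {the (\<sigma> i)}} = {i \<in> dom \<sigma>. v \<in> \<phi> i \<and> \<sigma> i \<noteq> Some v}"
      by force
    then show ?thesis
      using states_residual_degree[OF H \<sigma> assms(3,4), of v] by (simp only: residual_degree_def)
  qed
  show "real (card {i \<in> dom \<sigma>. u \<in> \<phi> i - {the (\<sigma> i)} \<and> v \<in> \<phi> i - {the (\<sigma> i)}}) \<le> B"
    if "u \<noteq> v" for u v
  proof -
    have "card {i \<in> dom \<sigma>. u \<in> \<phi> i - {the (\<sigma> i)} \<and> v \<in> \<phi> i - {the (\<sigma> i)}}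
        \<le> card {i \<in> J. u \<in> \<phi> i \<and> v \<in> \<phi> i}"
      using domJ finJ by (intro card_mono) auto
    then show ?thesis using codeg[OF that] by linarith
  qed
qed

text \<open>The complements \<open>A - Z\<close> are the containers: every independent set lies in
  one of them.\<close>

definition avoided_family :: "real \<Rightarrow> 'a set \<Rightarrow> 'i set \<Rightarrow> ('i \<Rightarrow> 'a set) \<Rightarrow> nat \<Rightarrow> 'a set set \<Rightarrow> bool" where
  "avoided_family c A J \<phi> n \<Z> \<longleftrightarrow>
     finite \<Z> \<and> card \<Z> \<le> n \<and> (\<forall>Z\<in>\<Z>. Z \<subseteq> A \<and> c * real (card A) \<le> real (card Z)) \<and>
     (\<forall>I\<subseteq>A. (\<forall>i\<in>J. \<not> \<phi> i \<subseteq> I) \<longrightarrow> (\<exists>Z\<in>\<Z>. Z \<inter> I = {}))"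

text \<open>
  An independent set \<open>I\<close> is queried greedily.  Either the queries stop early, and \<open>I\<close> misses all
  vertices whose query would still gain much, or the \<open>s\<close> queried vertices produce a hypergraph of
  smaller uniformity in which \<open>I\<close> is still independent.  As edges keep their indices, codegrees do
  not grow.
\<close>
lemma container_family:
  fixes K B :: real
  assumes "K \<ge> 1" "B > 0"
  shows "\<exists>c>0. \<forall>(A :: 'a set) (J :: 'i set) \<phi> d s.
    d > 0 \<longrightarrow> bounded_hypergraph (Suc r) (K * d) B A J \<phi> \<longrightarrow> d * real (card A) \<le> real (card J) \<longrightarrow>
    real s \<le> c * real (card A) \<longrightarrow> B \<le> d * (real s / (4 * real (card A))) ^ r \<longrightarrow>
    (\<exists>\<Z>. avoided_family c A J \<phi> ((card A + 1) ^ (s * r)) \<Z>)"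
  using assms(1)
proof (induction r arbitrary: K)
  case 0
  have "\<exists>\<Z>. avoided_family (1 / K) A J \<phi> ((card A + 1) ^ (s * 0)) \<Z>"
    if d: "d > 0" and H: "bounded_hypergraph (Suc 0) (K * d) B A J \<phi>"
      and edges: "d * real (card A) \<le> real (card J)"
    for A :: "'a set" and J :: "'i set" and \<phi> d s
  proof -
    have finA: "finite A" and finJ: "finite J"
      and \<phi>: "\<And>i. i \<in> J \<Longrightarrow> \<phi> i \<subseteq> A" "\<And>i. i \<in> J \<Longrightarrow> card (\<phi> i) = Suc 0"
      and deg: "\<And>v. real (card {i \<in> J. v \<in> \<phi> i}) \<le> K * d"
      using H by (auto simp: bounded_hypergraph_def)
    \<comment> \<open>Edges are singletons here, so an independent set misses every covered vertex
      and a single set suffices. It is large because each vertex lies in at most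
      \<open>K * d\<close> edges.\<close>
    define Z where "Z = (\<Union>i\<in>J. \<phi> i)"
    have ZA: "Z \<subseteq> A" using \<phi>(1) by (auto simp: Z_def)
    then have finZ: "finite Z" using finA finite_subset by blast
    have ne: "\<phi> i \<noteq> {}" if "i \<in> J" for i using \<phi>(2)[OF that] by auto
    have "J = {i \<in> J. \<exists>v\<in>Z. v \<in> \<phi> i}" using ne by (fastforce simp: Z_def)
    then have "real (card J) \<le> real (card Z) * (K * d)"
      using card_incident_le[OF finZ finJ deg] by simp
    then have "d * real (card A) \<le> d * (K * real (card Z))"
      using edges by (simp add: algebra_simps)
    then have "1 / K * real (card A) \<le> real (card Z)"
      using d 0 by (simp add: field_simps)
    moreover have "Z \<inter> I = {}" if I: "\<forall>i\<in>J. \<not> \<phi> i \<subseteq> I" for I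
    proof -
      have "v \<notin> I" if "i \<in> J" "v \<in> \<phi> i" for i v
      proof -
        have "\<phi> i = {v}" using \<phi>(2)[OF that(1)] that(2) by (auto simp: card_Suc_eq)
        then show ?thesis using I that by auto
      qed
      then show ?thesis by (auto simp: Z_def)
    qed
    ultimately have "avoided_family (1 / K) A J \<phi> ((card A + 1) ^ (s * 0)) {Z}"
      using ZA by (auto simp: avoided_family_def)
    then show ?thesis by blast
  qed
  then show ?case using 0 by (intro exI[of _ "1 / K"]) auto
next
  case (Suc r)
  \<comment> \<open>For the new average degree \<open>d'\<close> below, \<open>\<Delta>\<close> is
    \<open>16 * real (Suc (Suc r)) * K\<^sup>2 * d'\<close>; the summand 1 absorbs \<open>B\<close>,
    which is at most \<open>d'\<close>.\<close>
  define K' where "K' = 16 * real (Suc (Suc r)) * K\<^sup>2 + 1"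
  have "K' \<ge> 1" by (simp add: K'_def)
  from Suc.IH[OF this] obtain c' where c': "c' > 0"
    and IH: "\<And>(A :: 'a set) (J :: 'i set) \<phi> d s.
      d > 0 \<Longrightarrow> bounded_hypergraph (Suc r) (K' * d) B A J \<phi> \<Longrightarrow> d * real (card A) \<le> real (card J) \<Longrightarrow>
      real s \<le> c' * real (card A) \<Longrightarrow> B \<le> d * (real s / (4 * real (card A))) ^ r \<Longrightarrow>
      (\<exists>\<Z>. avoided_family c' A J \<phi> ((card A + 1) ^ (s * r)) \<Z>)"
    by blast
  define c where "c = min c' (1 / (4 * K))"
  have c: "c > 0" "c \<le> c'" "c \<le> 1 / (4 * K)" using c' Suc.prems by (auto simp: c_def)
  have "\<exists>\<Z>. avoided_family c A J \<phi> ((card A + 1) ^ (s * Suc r)) \<Z>"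
    if d: "d > 0" and H: "bounded_hypergraph (Suc (Suc r)) (K * d) B A J \<phi>"
      and edges: "d * real (card A) \<le> real (card J)"
      and sc: "real s \<le> c * real (card A)"
      and B: "B \<le> d * (real s / (4 * real (card A))) ^ Suc r"
    for A :: "'a set" and J :: "'i set" and \<phi> d s
  proof -
    define a where "a = real (card A)"
    have finA: "finite A" using H by (simp add: bounded_hypergraph_def)
    \<comment> \<open>Since \<open>B\<close> is positive, its upper bound excludes
      \<open>s = 0\<close> and an empty \<open>A\<close>, where the quotient would be 0.\<close>
    have pow: "0 < (real s / (4 * real (card A))) ^ Suc r"
      by (rule zero_less_mult_pos[OF less_le_trans[OF assms(2) B] d])
    have "s \<noteq> 0" and "card A \<noteq> 0" using pow by (auto intro!: Nat.gr0I)
    then have s0: "s > 0" and a: "a > 0" by (auto simp: a_def)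
    have sK: "4 * K * real s \<le> real (card A)"
    proof -
      have "real s \<le> 1 / (4 * K) * real (card A)"
        using sc c(3) mult_right_mono[of c "1 / (4 * K)" "real (card A)"] by linarith
      then show ?thesis using Suc.prems by (simp add: field_simps)
    qed
    define \<Delta> where "\<Delta> = 4 * real (Suc (Suc r)) * K\<^sup>2 * (real s / real (card A)) * d"
    have \<Delta>0: "\<Delta> \<ge> 0" using d by (simp add: \<Delta>_def)
    \<comment> \<open>\<open>s\<close> queries that each gain at least \<open>d / 4\<close> edges
      give at least \<open>d' * card A\<close> edges in total.\<close>
    define d' where "d' = (real s / (4 * a)) * d"
    have d': "d' > 0" using s0 a d by (simp add: d'_def)
    let ?st = "states J \<phi> \<Delta> (d / 4)"
    define Zdir where "Zdir \<sigma> = {v \<in> A. d / 4 \<le> real (card (gain J \<phi> \<Delta> \<sigma> v))}" for \<sigma>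
    have dir: "c * real (card A) \<le> real (card (Zdir \<sigma>))" if "\<sigma> \<in> ?st A l" "l \<le> s" for \<sigma> l
    proof -
      have "real (card A) \<le> 4 * K * real (card (Zdir \<sigma>))"
        unfolding Zdir_def
        by (rule many_gainful_vertices[OF H edges that Suc.prems d s0 sK \<Delta>_def])
      then have "1 / (4 * K) * real (card A) \<le> real (card (Zdir \<sigma>))"
        using Suc.prems by (simp add: field_simps)
      then show ?thesis
        using c(3) mult_right_mono[of c "1 / (4 * K)" "real (card A)"] by linarith
    qed
    have "real s / (4 * a) \<le> 1"
    proof -
      have "1 * real s \<le> (4 * K) * real s" using Suc.prems by (intro mult_right_mono) auto
      then show ?thesis using sK a by (simp add: a_def field_simps)
    qed
    then have le1: "(real s / (4 * a)) ^ r \<le> 1" using a by (intro power_le_one) auto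
    have Bd': "B \<le> d' * (real s / (4 * a)) ^ r"
      using B by (simp add: d'_def a_def algebra_simps)
    also have "\<dots> \<le> d'" using le1 d' by (simp add: mult_left_le)
    finally have "B \<le> d'" .
    moreover have "\<Delta> = 16 * real (Suc (Suc r)) * K\<^sup>2 * d'"
      using a by (simp add: \<Delta>_def d'_def a_def field_simps)
    ultimately have \<Delta>B: "\<Delta> + B \<le> K' * d'" by (simp add: K'_def distrib_right del: of_nat_Suc)
    have "\<exists>\<Z>. avoided_family c' A (dom \<sigma>) (\<lambda>i. \<phi> i - {the (\<sigma> i)}) ((card A + 1) ^ (s * r)) \<Z>"
      if \<sigma>: "\<sigma> \<in> ?st A s" for \<sigma>
    proof (rule IH[OF d'])
      have "bounded_hypergraph (Suc r) (\<Delta> + B) B A (dom \<sigma>) (\<lambda>i. \<phi> i - {the (\<sigma> i)})"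
        by (rule residual_hypergraph[OF H \<sigma> \<Delta>0]) (use assms(2) in simp)
      then show "bounded_hypergraph (Suc r) (K' * d') B A (dom \<sigma>) (\<lambda>i. \<phi> i - {the (\<sigma> i)})"
        using \<Delta>B by (rule bounded_hypergraph_mono)
      show "d' * real (card A) \<le> real (card (dom \<sigma>))"
        using states_card_dom(1)[OF H \<sigma>] a by (simp add: d'_def a_def)
      show "real s \<le> c' * real (card A)"
        using sc c(2) mult_right_mono[of c c' "real (card A)"] by linarith
      show "B \<le> d' * (real s / (4 * real (card A))) ^ r"
        using Bd' by (simp add: a_def)
    qed
    then have "\<forall>\<sigma>\<in>?st A s. \<exists>\<Z>.
        avoided_family c' A (dom \<sigma>) (\<lambda>i. \<phi> i - {the (\<sigma> i)}) ((card A + 1) ^ (s * r)) \<Z>"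
      by blast
    from bchoice[OF this] obtain \<Y> where \<Y>: "\<And>\<sigma>. \<sigma> \<in> ?st A s \<Longrightarrow>
        avoided_family c' A (dom \<sigma>) (\<lambda>i. \<phi> i - {the (\<sigma> i)}) ((card A + 1) ^ (s * r)) (\<Y> \<sigma>)"
      by blast
    \<comment> \<open>Runs that stop early contribute the vertices still of large gain; runs of full
      length contribute the families from the induction hypothesis.\<close>
    define \<Z> where "\<Z> = (\<Union>l<s. Zdir ` ?st A l) \<union> (\<Union>\<sigma>\<in>?st A s. \<Y> \<sigma>)"
    have fin: "finite (?st A l)" and cst: "card (?st A l) \<le> card A ^ l" for l
      using finite_card_states[OF finA] by blast+
    have finY: "finite (\<Y> \<sigma>)" "card (\<Y> \<sigma>) \<le> (card A + 1) ^ (s * r)" if "\<sigma> \<in> ?st A s" for \<sigma>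
      using \<Y>[OF that] by (auto simp: avoided_family_def)
    have "finite \<Z>" using fin finY by (auto simp: \<Z>_def)
    moreover have "card \<Z> \<le> (card A + 1) ^ (s * Suc r)"
    proof -
      let ?p = "(card A + 1) ^ (s * r)"
      have "card (\<Union>l<s. Zdir ` ?st A l) \<le> (\<Sum>l<s. card (Zdir ` ?st A l))"
        by (rule card_UN_le) simp
      also have "\<dots> \<le> (\<Sum>l<s. card A ^ l)"
        by (intro sum_mono order_trans[OF card_image_le[OF fin] cst])
      also have "\<dots> \<le> (\<Sum>l<s. card A ^ l) * ?p" by simp
      finally have 1: "card (\<Union>l<s. Zdir ` ?st A l) \<le> (\<Sum>l<s. card A ^ l) * ?p" .
      have "card (\<Union>\<sigma>\<in>?st A s. \<Y> \<sigma>) \<le> (\<Sum>\<sigma>\<in>?st A s. card (\<Y> \<sigma>))"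
        by (rule card_UN_le[OF fin])
      also have "\<dots> \<le> card (?st A s) * ?p"
        using sum_bounded_above[of "?st A s" "\<lambda>\<sigma>. card (\<Y> \<sigma>)" ?p] finY(2) by simp
      also have "\<dots> \<le> card A ^ s * ?p" using cst by (intro mult_right_mono) auto
      finally have 2: "card (\<Union>\<sigma>\<in>?st A s. \<Y> \<sigma>) \<le> card A ^ s * ?p" .
      have "card \<Z> \<le> card (\<Union>l<s. Zdir ` ?st A l) + card (\<Union>\<sigma>\<in>?st A s. \<Y> \<sigma>)"
        unfolding \<Z>_def by (rule card_Un_le)
      also have "\<dots> \<le> (\<Sum>l\<le>s. card A ^ l) * ?p"
        using 1 2 by (simp add: lessThan_Suc_atMost[symmetric] distrib_right del: One_nat_def)
      also have "\<dots> \<le> (card A + 1) ^ s * ?p"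
        using sum_powers_le by (intro mult_right_mono) auto
      also have "\<dots> = (card A + 1) ^ (s * Suc r)" by (simp add: power_add)
      finally show ?thesis .
    qed
    moreover have "Z \<subseteq> A \<and> c * real (card A) \<le> real (card Z)" if "Z \<in> \<Z>" for Z
    proof -
      from that consider l \<sigma> where "l < s" "\<sigma> \<in> ?st A l" "Z = Zdir \<sigma>"
        | \<sigma> where "\<sigma> \<in> ?st A s" "Z \<in> \<Y> \<sigma>"
        unfolding \<Z>_def by blast
      then show ?thesis
      proof cases
        case 1
        then show ?thesis using dir[of \<sigma> l] by (auto simp: Zdir_def)
      next
        case 2
        then have "Z \<subseteq> A" "c' * real (card A) \<le> real (card Z)"
          using \<Y>[OF 2(1)] by (auto simp: avoided_family_def)
        then show ?thesis using c(2) mult_right_mono[of c c' "real (card A)"] by auto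
      qed
    qed
    moreover have "\<exists>Z\<in>\<Z>. Z \<inter> I = {}" if IA: "I \<subseteq> A" and ind: "\<forall>i\<in>J. \<not> \<phi> i \<subseteq> I" for I
    proof -
      obtain l \<sigma> where l: "l \<le> s" "\<sigma> \<in> ?st I l"
        "l = s \<or> (\<forall>v\<in>I. real (card (gain J \<phi> \<Delta> \<sigma> v)) < d / 4)"
        using states_stop by blast
      have \<sigma>A: "\<sigma> \<in> ?st A l" using l(2) states_mono[OF IA] by blast
      show ?thesis
      proof (cases "l = s")
        case True
        \<comment> \<open>The run queries only vertices of \<open>I\<close>, so the vertex removed
          from edge \<open>i\<close> lies in \<open>I\<close>; if the rest did too, the whole edge
          would.\<close>
        have "\<not> \<phi> i - {the (\<sigma> i)} \<subseteq> I" if "i \<in> dom \<sigma>" for i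
        proof -
          from that obtain v where v: "\<sigma> i = Some v" by blast
          then have "v \<in> I" using states_assigned(2)[OF l(2)] by blast
          moreover have "\<not> \<phi> i \<subseteq> I" using ind that states_assigned(1)[OF l(2)] by blast
          ultimately show ?thesis using v by auto
        qed
        then have "\<exists>Z\<in>\<Y> \<sigma>. Z \<inter> I = {}"
          using \<Y>[of \<sigma>] \<sigma>A True IA by (auto simp: avoided_family_def)
        then show ?thesis using \<sigma>A True unfolding \<Z>_def by blast
      next
        case False
        then have "Zdir \<sigma> \<inter> I = {}" using l(3) by (force simp: Zdir_def)
        moreover have "Zdir \<sigma> \<in> \<Z>" using \<sigma>A False l(1) by (auto simp: \<Z>_def)
        ultimately show ?thesis by blast
      qed
    qed
    ultimately have "avoided_family c A J \<phi> ((card A + 1) ^ (s * Suc r)) \<Z>"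
      unfolding avoided_family_def by blast
    then show ?thesis by blast
  qed
  then show ?case using c(1) by (intro exI[of _ c]) blast
qed

text \<open>Makes the maximum degree comparable to the average, as containers require. Take a
  largest subfamily obeying the degree bound. If it were too small, fewer than half of the vertices
  would have degree above \<open>2 * r * d\<close>; by supersaturation the others span more edges
  than the subfamily has, so a new edge avoiding the full vertices could be added.\<close>

lemma bounded_degree_subfamily:
  fixes d :: real
  assumes finA: "finite A" and finJ: "finite J" and r: "\<And>i. i \<in> J \<Longrightarrow> card (\<phi> i) = r"
    and "r > 0" "d > 0"
    and supersat: "\<And>A'. A' \<subseteq> A \<Longrightarrow> card A \<le> 2 * card A' \<Longrightarrow>
      2 * d * real (card A') \<le> real (card {i \<in> J. \<phi> i \<subseteq> A'})"
  shows "\<exists>F\<subseteq>{i \<in> J. \<phi> i \<subseteq> A}. d * real (card A) \<le> real (card F) \<and>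
    (\<forall>v. real (card {i \<in> F. v \<in> \<phi> i}) \<le> 2 * real r * d + 1)"
proof -
  define P where "P F \<longleftrightarrow> F \<subseteq> {i \<in> J. \<phi> i \<subseteq> A} \<and>
    (\<forall>v. real (card {i \<in> F. v \<in> \<phi> i}) \<le> 2 * real r * d + 1)" for F
  have "P {}" using \<open>d > 0\<close> by (simp add: P_def)
  moreover have "card F < Suc (card J)" if "P F" for F
    using that finJ by (auto simp: P_def less_Suc_eq_le intro!: card_mono)
  ultimately obtain F where PF: "P F" and max: "\<And>G. P G \<Longrightarrow> card G \<le> card F"
    using ex_has_greatest_nat[of P "{}" card "Suc (card J)"] by (metis less_imp_le)
  have FJ: "F \<subseteq> {i \<in> J. \<phi> i \<subseteq> A}" and deg: "\<And>v. real (card {i \<in> F. v \<in> \<phi> i}) \<le> 2 * real r * d + 1"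
    using PF by (auto simp: P_def)
  have finF: "finite F" using FJ finJ by (auto intro: finite_subset)
  have "d * real (card A) \<le> real (card F)"
  proof (rule ccontr)
    assume "\<not> ?thesis"
    then have lt: "real (card F) < d * real (card A)" by simp
    define X where "X = {v \<in> A. 2 * real r * d < real (card {i \<in> F. v \<in> \<phi> i})}"
    have XA: "X \<subseteq> A" and finX: "finite X" using finA by (auto simp: X_def)
    have "real (card X) * (2 * real r * d) \<le> (\<Sum>v\<in>X. real (card {i \<in> F. v \<in> \<phi> i}))"
      by (rule sum_bounded_below) (auto simp: X_def)
    also have "\<dots> \<le> (\<Sum>v\<in>A. real (card {i \<in> F. v \<in> \<phi> i}))"
      using XA finA by (intro sum_mono2) auto
    also have "\<dots> = real (\<Sum>i\<in>F. card (\<phi> i))"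
      unfolding of_nat_sum[symmetric] using FJ
      by (intro arg_cong[where f = real] sum_degrees[OF finA finF]) auto
    also have "\<dots> = real r * real (card F)"
      using r FJ by (subst sum.cong[of _ _ _ "\<lambda>_. r"]) (auto simp: algebra_simps)
    also have "\<dots> < real r * (d * real (card A))"
      using lt \<open>r > 0\<close> by simp
    finally have "(2 * real (card X)) * (real r * d) < real (card A) * (real r * d)"
      by (simp add: algebra_simps)
    then have X: "2 * real (card X) < real (card A)"
      using \<open>r > 0\<close> \<open>d > 0\<close> by (simp add: mult_less_cancel_right)
    have cAX: "real (card (A - X)) = real (card A) - real (card X)"
      using XA finX card_mono[OF finA XA] by (simp add: card_Diff_subset of_nat_diff)
    have big: "real (card A) < 2 * real (card (A - X))" using X cAX by linarith
    then have "2 * d * real (card (A - X)) \<le> real (card {i \<in> J. \<phi> i \<subseteq> A - X})"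
      by (intro supersat) auto
    moreover have "d * real (card A) \<le> d * (2 * real (card (A - X)))"
      using big \<open>d > 0\<close> by (intro mult_left_mono) auto
    ultimately have "card F < card {i \<in> J. \<phi> i \<subseteq> A - X}" using lt by simp
    then have "\<not> {i \<in> J. \<phi> i \<subseteq> A - X} \<subseteq> F"
      using card_mono[OF finF] by (meson not_less)
    then obtain e where e: "e \<in> J" "\<phi> e \<subseteq> A - X" "e \<notin> F" by blast
    have "P (insert e F)"
      unfolding P_def
    proof (intro conjI allI)
      show "insert e F \<subseteq> {i \<in> J. \<phi> i \<subseteq> A}" using e FJ by auto
      fix v
      show "real (card {i \<in> insert e F. v \<in> \<phi> i}) \<le> 2 * real r * d + 1"
      proof (cases "v \<in> \<phi> e")
        case True
        then have "{i \<in> insert e F. v \<in> \<phi> i} = insert e {i \<in> F. v \<in> \<phi> i}" by auto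
        then have "card {i \<in> insert e F. v \<in> \<phi> i} = Suc (card {i \<in> F. v \<in> \<phi> i})"
          using finF e by simp
        moreover have "real (card {i \<in> F. v \<in> \<phi> i}) \<le> 2 * real r * d"
          using True e(2) by (auto simp: X_def not_less)
        ultimately show ?thesis by simp
      next
        case False
        then have "{i \<in> insert e F. v \<in> \<phi> i} = {i \<in> F. v \<in> \<phi> i}" by auto
        then show ?thesis using deg by simp
      qed
    qed
    from max[OF this] show False using e(3) finF by simp
  qed
  then show ?thesis using FJ deg by blast
qed

text \<open>Iterated containers. Passing from \<open>A\<close> to \<open>A - Z\<close> lowers the
  exponent \<open>q * card A\<close> by at least \<open>c * q * card A\<close>, which pays for the
  number of choices of \<open>Z\<close>. Below size \<open>m\<close> all subsets are
  counted.\<close>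

lemma card_independent_le:
  fixes c q Y :: real
  assumes finV: "finite V" and "c > 0" "q \<ge> 0" "Y \<ge> 1" "m > 0"
    and fam: "\<And>A. A \<subseteq> V \<Longrightarrow> m \<le> card A \<Longrightarrow> \<exists>\<Z>. finite \<Z> \<and>
      real (card \<Z>) \<le> Y powr (c * q * real (card A)) \<and>
      (\<forall>Z\<in>\<Z>. Z \<subseteq> A \<and> c * real (card A) \<le> real (card Z)) \<and>
      (\<forall>I\<subseteq>A. P I \<longrightarrow> (\<exists>Z\<in>\<Z>. Z \<inter> I = {}))"
    and "A \<subseteq> V"
  shows "real (card {I. I \<subseteq> A \<and> P I}) \<le> Y powr (q * real (card A)) * 2 ^ m"
proof -
  have "finite A" using finV \<open>A \<subseteq> V\<close> finite_subset by blast
  then show ?thesis using \<open>A \<subseteq> V\<close>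
  proof (induction A rule: finite_psubset_induct)
    case (psubset A)
    show ?case
    proof (cases "m \<le> card A")
      case False
      have "card {I. I \<subseteq> A \<and> P I} \<le> card (Pow A)"
        using psubset.hyps by (intro card_mono) auto
      then have "real (card {I. I \<subseteq> A \<and> P I}) \<le> 2 ^ card A"
        using psubset.hyps by (simp add: card_Pow)
      also have "\<dots> \<le> (2::real) ^ m" using False by (intro power_increasing) auto
      also have "\<dots> \<le> Y powr (q * real (card A)) * 2 ^ m"
        using \<open>Y \<ge> 1\<close> \<open>q \<ge> 0\<close> by (simp add: ge_one_powr_ge_zero)
      finally show ?thesis .
    next
      case True
      then obtain \<Z> where fin: "finite \<Z>"
        and card: "real (card \<Z>) \<le> Y powr (c * q * real (card A))"
        and Z: "\<And>Z. Z \<in> \<Z> \<Longrightarrow> Z \<subseteq> A \<and> c * real (card A) \<le> real (card Z)"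
        and ind: "\<And>I. I \<subseteq> A \<Longrightarrow> P I \<Longrightarrow> \<exists>Z\<in>\<Z>. Z \<inter> I = {}"
        using fam[OF psubset.prems] by metis
      let ?U = "Y powr (q * (1 - c) * real (card A)) * 2 ^ m"
      have bound: "real (card {I. I \<subseteq> A - Z \<and> P I}) \<le> ?U" if "Z \<in> \<Z>" for Z
      proof -
        have ZA: "Z \<subseteq> A" "c * real (card A) \<le> real (card Z)" using Z[OF that] by auto
        have finZ: "finite Z" using ZA(1) psubset.hyps finite_subset by blast
        have "0 < c * real (card A)" using True \<open>m > 0\<close> \<open>c > 0\<close> by simp
        then have "Z \<noteq> {}" using ZA(2) by auto
        then have "A - Z \<subset> A" using ZA(1) by auto
        from psubset.IH[OF this] have
          "real (card {I. I \<subseteq> A - Z \<and> P I}) \<le> Y powr (q * real (card (A - Z))) * 2 ^ m"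
          using psubset.prems by blast
        also have "\<dots> \<le> ?U"
        proof (intro mult_right_mono powr_mono)
          have "real (card (A - Z)) = real (card A) - real (card Z)"
            using ZA(1) finZ card_mono[OF \<open>finite A\<close> ZA(1)]
            by (simp add: card_Diff_subset of_nat_diff)
          then have "real (card (A - Z)) \<le> (1 - c) * real (card A)"
            using ZA(2) by (simp add: algebra_simps)
          then show "q * real (card (A - Z)) \<le> q * (1 - c) * real (card A)"
            using \<open>q \<ge> 0\<close> by (simp add: mult_left_mono mult.assoc)
        qed (use \<open>Y \<ge> 1\<close> in auto)
        finally show ?thesis .
      qed
      have "{I. I \<subseteq> A \<and> P I} \<subseteq> (\<Union>Z\<in>\<Z>. {I. I \<subseteq> A - Z \<and> P I})"
      proof
        fix I assume "I \<in> {I. I \<subseteq> A \<and> P I}"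
        then have "I \<subseteq> A" "P I" by auto
        with ind[OF this] show "I \<in> (\<Union>Z\<in>\<Z>. {I. I \<subseteq> A - Z \<and> P I})" by auto
      qed
      then have "card {I. I \<subseteq> A \<and> P I} \<le> card (\<Union>Z\<in>\<Z>. {I. I \<subseteq> A - Z \<and> P I})"
        using fin psubset.hyps by (intro card_mono) auto
      also have "\<dots> \<le> (\<Sum>Z\<in>\<Z>. card {I. I \<subseteq> A - Z \<and> P I})"
        by (rule card_UN_le[OF fin])
      finally have "real (card {I. I \<subseteq> A \<and> P I}) \<le> (\<Sum>Z\<in>\<Z>. real (card {I. I \<subseteq> A - Z \<and> P I}))"
        unfolding of_nat_sum[symmetric] of_nat_le_iff .
      also have "\<dots> \<le> real (card \<Z>) * ?U" by (rule sum_bounded_above) (rule bound)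
      also have "\<dots> \<le> Y powr (c * q * real (card A)) * ?U"
        using card by (intro mult_right_mono) auto
      also have "\<dots> = Y powr (q * real (card A)) * 2 ^ m"
        by (simp add: powr_add[symmetric] algebra_simps)
      finally show ?thesis .
    qed
  qed
qed

section \<open>A lower bound for the number of primes\<close>

text \<open>\<open>Q\<close> is the least common multiple of \<open>1, ..., m\<close>: the product
  over the primes \<open>p \<le> m\<close> of the largest power of \<open>p\<close> not exceeding
  \<open>m\<close>.\<close>

lemma prod_prime_powers_multiple:
  fixes m :: nat
  assumes "0 < m"
  obtains Q :: nat where "0 < Q" "Q \<le> m ^ card {p. prime p \<and> p \<le> m}" "\<And>i. 1 \<le> i \<Longrightarrow> i \<le> m \<Longrightarrow> i dvd Q"
proof -
  define S where "S = {p. prime p \<and> p \<le> m}"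
  define e where "e p = (GREATEST a. p ^ a \<le> m)" for p :: nat
  have finS: "finite S" by (rule finite_subset[of _ "{..m}"]) (auto simp: S_def)
  \<comment> \<open>Bounds the exponents, so that \<open>GREATEST\<close> is attained.\<close>
  have bd: "a \<le> m" if "p ^ a \<le> m" "p \<in> S" for p a
  proof -
    have "2 \<le> p" using that(2) prime_ge_2_nat by (auto simp: S_def)
    have "a < 2 ^ a" by simp
    also have "\<dots> \<le> p ^ a" using \<open>2 \<le> p\<close> by (rule power_mono) simp
    finally show ?thesis using that(1) by simp
  qed
  have e1: "p ^ e p \<le> m" if "p \<in> S" for p
    unfolding e_def by (rule GreatestI_nat[of _ 0 m]) (use assms bd that in auto)
  have e2: "a \<le> e p" if "p ^ a \<le> m" "p \<in> S" for p a
    unfolding e_def by (rule Greatest_le_nat[of _ _ m]) (use that bd in auto)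
  define Q where "Q = (\<Prod>p\<in>S. p ^ e p)"
  have "0 < Q" unfolding Q_def by (rule prod_pos) (auto simp: S_def prime_gt_0_nat)
  moreover have "Q \<le> m ^ card S" unfolding Q_def using e1 assms by (intro prod_le_power) auto
  moreover have "i dvd Q" if "1 \<le> i" "i \<le> m" for i
  proof -
    have "i = (\<Prod>p\<in>prime_factors i. p ^ multiplicity p i)"
      using prime_factorization_nat[of i] that by simp
    also have "\<dots> dvd Q" unfolding Q_def
    proof (rule prod_dvd_prod_subset2[OF finS])
      show sub: "prime_factors i \<subseteq> S"
      proof
        fix p assume "p \<in> prime_factors i"
        then have "prime p" "p dvd i" by auto
        moreover from this(2) have "p \<le> i" using that by (intro dvd_imp_le) auto
        ultimately show "p \<in> S" using that by (simp add: S_def)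
      qed
      fix p assume p: "p \<in> prime_factors i"
      have "p ^ multiplicity p i \<le> i"
        using multiplicity_dvd[of p i] that by (intro dvd_imp_le) auto
      then show "p ^ multiplicity p i dvd p ^ e p"
        using e2[of p "multiplicity p i"] that p sub by (intro le_imp_power_dvd) auto
    qed
    finally show ?thesis .
  qed
  ultimately show ?thesis using that[of Q] by (simp add: S_def)
qed

text \<open>The numbers \<open>1 / (j * (n choose j))\<close> form Leibniz's harmonic triangle. Its
  difference rule follows from the two absorption identities \<open>1\<close> and \<open>2\<close>
  for binomial coefficients.\<close>

lemma leibniz_triangle:
  assumes "1 \<le> j" "j \<le> n"
  shows "1 / (real (Suc j) * real (Suc n choose Suc j))
    = 1 / (real j * real (n choose j)) - 1 / (real j * real (Suc n choose j))"
proof -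
  have 1: "real (Suc j) * real (Suc n choose Suc j) = real (Suc n) * real (n choose j)"
    by (metis Suc_times_binomial of_nat_mult)
  have "(Suc n - j) * (Suc n choose j) = Suc n * (n choose j)"
    using binomial_absorb_comp[of "Suc n" j] by simp
  then have 2: "(real (Suc n) - real j) * real (Suc n choose j) = real (Suc n) * real (n choose j)"
    using assms by (metis of_nat_mult of_nat_diff le_SucI)
  have pos: "real (n choose j) > 0" "real (Suc n choose j) > 0" "real j > 0" "real (Suc n) > 0"
    using assms by auto
  have "1 / (N * X) = 1 / (J * X) - 1 / (J * Y)"
    if "X > 0" "Y > 0" "J > 0" "N > 0" "(N - J) * Y = N * X" for N J X Y :: real
  proof -
    have "1 / (J * X) - 1 / (J * Y) = (N * (Y - X)) / (J * X * Y * N)"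
      using that(1-4) by (simp add: field_simps)
    also have "N * (Y - X) = J * Y" using that(5) by (simp add: algebra_simps)
    finally show ?thesis using that(1-4) by simp
  qed
  from this[OF pos 2] show ?thesis unfolding 1 .
qed

text \<open>\<open>Q\<close> times an entry of the harmonic triangle is an integer: for
  \<open>j = 1\<close> the entries are \<open>1 / n\<close> with \<open>n\<close> dividing
  \<open>Q\<close>, and differences preserve integrality. A positive integer is at least 1.\<close>

lemma mult_binomial_le_of_common_multiple:
  fixes Q :: nat
  assumes Q: "0 < Q" "\<And>i. 1 \<le> i \<Longrightarrow> i \<le> m \<Longrightarrow> i dvd Q" and "1 \<le> j" "j \<le> n" "n \<le> m"
  shows "j * (n choose j) \<le> Q"
proof -
  have int: "real Q / (real j * real (n choose j)) \<in> \<int>"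
    using assms(3-)
  proof (induction j arbitrary: n rule: nat_induct_at_least)
    case base
    then have "n dvd Q" using Q(2) by auto
    then show ?case by auto
  next
    case (Suc j)
    then obtain n' where n: "n = Suc n'" "j \<le> n'" by (cases n) auto
    have "real Q / (real j * real (n' choose j)) \<in> \<int>" "real Q / (real j * real (n choose j)) \<in> \<int>"
      using Suc.IH[of n'] Suc.IH[of n] Suc.prems n by auto
    then have "real Q / (real j * real (n' choose j)) - real Q / (real j * real (n choose j)) \<in> \<int>"
      by (rule Ints_diff)
    also have "real Q / (real j * real (n' choose j)) - real Q / (real j * real (n choose j))
      = real Q * (1 / (real j * real (n' choose j)) - 1 / (real j * real (n choose j)))"
      by (simp add: algebra_simps)
    also have "\<dots> = real Q / (real (Suc j) * real (n choose Suc j))"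
      unfolding n(1) leibniz_triangle[OF Suc.hyps n(2), symmetric] by simp
    finally show ?case .
  qed
  have pos: "0 < real j * real (n choose j)" using assms by simp
  then have "0 < real Q / (real j * real (n choose j))" using Q(1) by simp
  then have "1 \<le> real Q / (real j * real (n choose j))"
    using int by (auto elim!: Ints_cases)
  then have "real (j * (n choose j)) \<le> real Q" using pos by (simp add: field_simps)
  then show ?thesis by (simp only: of_nat_le_iff)
qed

text \<open>A Chebyshev-type bound: \<open>n * (2 * n choose n)\<close> is at least
  \<open>4 ^ n / 2\<close> and at most the common multiple \<open>Q\<close>.\<close>

lemma prime_count_lower_bound:
  assumes "n \<ge> 1"
  shows "2 ^ n \<le> (2 * n) ^ card {p::nat. prime p \<and> p \<le> 2 * n}"
proof -
  have pos: "0 < 2 * n" using assms by simp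
  obtain Q where Q: "0 < Q" "Q \<le> (2 * n) ^ card {p::nat. prime p \<and> p \<le> 2 * n}"
    "\<And>i. 1 \<le> i \<Longrightarrow> i \<le> 2 * n \<Longrightarrow> i dvd Q"
    using prod_prime_powers_multiple[OF pos] by blast
  have "n * (2 * n choose n) \<le> Q"
    by (rule mult_binomial_le_of_common_multiple[OF Q(1,3), of "2 * n"]) (use assms in auto)
  moreover have "real (2 ^ n) \<le> real (n * (2 * n choose n))"
  proof -
    have "(2::real) * 2 ^ n \<le> 2 ^ n * 2 ^ n"
      using assms self_le_power[of "2::real" n] by (intro mult_right_mono) auto
    also have "\<dots> = 4 ^ n" by (simp add: power_mult_distrib[symmetric])
    also have "\<dots> \<le> 2 * (real n * real (2 * n choose n))"
      using central_binomial_lower_bound[of n] assms by (simp add: field_simps)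
    finally show ?thesis by simp
  qed
  ultimately show ?thesis using Q(2) by linarith
qed

section \<open>Supersaturation for corners\<close>

text \<open>The pairs of apex and difference serve as edge indices. For \<open>A\<close> inside the
  grid, the containment in \<open>A\<close> implies the grid conditions of
  \<open>is_corner\<close>.\<close>

definition corners_in :: "nat \<Rightarrow> (nat \<Rightarrow> nat) set \<Rightarrow> ((nat \<Rightarrow> nat) \<times> nat) set" where
  "corners_in k A = {(a, d). 0 < d \<and> corner k a d \<subseteq> A}"

lemma corner_free_iff: "corner_free k N A \<longleftrightarrow> A \<subseteq> grid k N \<and> corners_in k A = {}"
proof -
  have "(\<exists>S. is_corner k N S \<and> S \<subseteq> A) \<longleftrightarrow> corners_in k A \<noteq> {}" if A: "A \<subseteq> grid k N"
  proof
    assume "\<exists>S. is_corner k N S \<and> S \<subseteq> A"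
    then show "corners_in k A \<noteq> {}" by (auto simp: is_corner_def corners_in_def)
  next
    assume "corners_in k A \<noteq> {}"
    then obtain a d where ad: "d > 0" "corner k a d \<subseteq> A" by (auto simp: corners_in_def)
    moreover have "a \<in> grid k N" using ad(2) A by (auto simp: corner_def)
    ultimately have "is_corner k N (corner k a d)" using A unfolding is_corner_def by blast
    then show "\<exists>S. is_corner k N S \<and> S \<subseteq> A" using ad(2) by blast
  qed
  then show ?thesis unfolding corner_free_def by blast
qed

lemma corners_in_subset:
  assumes "A \<subseteq> grid k N" "k \<ge> 1"
  shows "corners_in k A \<subseteq> A \<times> {1..N}"
proof
  fix c assume "c \<in> corners_in k A"
  then obtain a d where c: "c = (a, d)" "0 < d" "corner k a d \<subseteq> A" by (auto simp: corners_in_def)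
  have a: "a \<in> A" using c(3) by (auto simp: corner_def)
  have "a(1 := a 1 + d) \<in> A" using c(3) assms(2) by (auto simp: corner_def)
  then have "a(1 := a 1 + d) \<in> grid k N" using assms(1) by blast
  then have "(a(1 := a 1 + d)) 1 \<in> {1..N}" unfolding grid_def by (rule PiE_mem) (use assms(2) in auto)
  then show "c \<in> A \<times> {1..N}" using a c by auto
qed

lemma finite_corners_in: "A \<subseteq> grid k N \<Longrightarrow> k \<ge> 1 \<Longrightarrow> finite (corners_in k A)"
  by (rule finite_subset[OF corners_in_subset]) (auto intro: finite_subset finite_grid)

lemma max_corner_free_ge: "corner_free k N A \<Longrightarrow> card A \<le> max_corner_free k N"
  unfolding max_corner_free_def
  by (rule Max_ge) (use finite_corner_free[of k N] in auto)

lemma max_corner_free_attained: "\<exists>A. corner_free k N A \<and> card A = max_corner_free k N"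
proof -
  have "max_corner_free k N \<in> {card A | A. corner_free k N A}"
    unfolding max_corner_free_def
    by (rule Max_in) (use finite_corner_free[of k N] corner_free_empty[of k N] in auto)
  then show ?thesis by auto
qed

section \<open>Codegrees of the corner hypergraph\<close>

lemma card_grid: "card (grid k N) = N ^ k"
  by (simp add: grid_def card_PiE)

text \<open>Numbers the points of a corner; 0 is free to denote the apex because directions start at
  1.\<close>

definition corner_point :: "(nat \<Rightarrow> nat) \<Rightarrow> nat \<Rightarrow> nat \<Rightarrow> nat \<Rightarrow> nat" where
  "corner_point a d p = (if p = 0 then a else a(p := a p + d))"

lemma corner_eq: "corner k a d = corner_point a d ` {0..k}"
proof -
  have "{0..k} = insert 0 {1..k}" by auto
  then show ?thesis by (auto simp: corner_def corner_point_def)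
qed

lemma card_corner:
  assumes "d > 0" shows "card (corner k a d) = Suc k"
proof -
  have "inj_on (corner_point a d) {0..k}"
  proof (rule inj_onI)
    fix p q assume "corner_point a d p = corner_point a d q"
    then have "corner_point a d p p = corner_point a d q p" "corner_point a d p q = corner_point a d q q"
      by simp_all
    then show "p = q" using assms by (auto simp: corner_point_def split: if_splits)
  qed
  then show ?thesis by (simp add: corner_eq card_image)
qed

text \<open>Two distinct points and their positions in the corner determine it, and there are
  \<open>(k + 1)\<^sup>2\<close> pairs of positions.\<close>

lemma card_corners_through_pair:
  assumes "u \<noteq> v"
  shows "card {c \<in> corners_in k A. u \<in> corner k (fst c) (snd c) \<and> v \<in> corner k (fst c) (snd c)}
    \<le> (k + 1)\<^sup>2"
proof -
  \<comment> \<open>Recovers apex and difference. If neither point is the apex, then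
    \<open>v\<close> agrees with the apex in coordinate \<open>p\<close>, which undoes the shift of
    \<open>u\<close>.\<close>
  define G where "G = (\<lambda>(p, q). if p = 0 then (u, v q - u q)
    else if q = 0 then (v, u p - v p) else (u(p := v p), u p - v p))"
  have "{c \<in> corners_in k A. u \<in> corner k (fst c) (snd c) \<and> v \<in> corner k (fst c) (snd c)}
    \<subseteq> G ` ({0..k} \<times> {0..k})"
  proof
    fix c assume "c \<in> {c \<in> corners_in k A. u \<in> corner k (fst c) (snd c) \<and> v \<in> corner k (fst c) (snd c)}"
    then obtain a d p q where c: "c = (a, d)" "p \<in> {0..k}" "q \<in> {0..k}"
      "u = corner_point a d p" "v = corner_point a d q"
      by (cases c) (auto simp: corner_eq)
    then have "p \<noteq> q" using assms by auto
    then have "c = G (p, q)"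
      unfolding c(1) G_def using c(4,5) by (auto simp: corner_point_def)
    then show "c \<in> G ` ({0..k} \<times> {0..k})" using c by blast
  qed
  from surj_card_le[OF _ this] show ?thesis
    by (simp add: card_cartesian_product power2_eq_square)
qed

text \<open>Pigeonhole over the dilated blocks \<open>r + p(M b + [M]^k)\<close> that partition \<open>[N]^k\<close>.\<close>
lemma corner_with_multiple_difference:
  assumes A: "A \<subseteq> grid k N" and "p \<ge> 1" "M \<ge> 1"
    and big: "(p * (N div (p * M) + 1)) ^ k * max_corner_free k M < card A"
  shows "\<exists>(a, d)\<in>corners_in k A. p dvd d"
proof -
  \<comment> \<open>After a shift to coordinates starting at 0, each coordinate is a residue modulo
    \<open>p\<close> plus \<open>p\<close> times a number that splits into a block index and a
    position below \<open>M\<close>. \<open>pos\<close> shifts the position back to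
    \<open>{1..M}\<close>.\<close>
  define blk where "blk y = (\<lambda>i\<in>{1..k}. ((y i - 1) mod p, (y i - 1) div p div M))" for y :: "nat \<Rightarrow> nat"
  define pos where "pos y = (\<lambda>i\<in>{1..k}. (y i - 1) div p mod M + 1)" for y :: "nat \<Rightarrow> nat"
  define Bl where "Bl = ({1..k} \<rightarrow>\<^sub>E ({..<p} \<times> {..N div (p * M)}))"
  have finA: "finite A" using A finite_grid finite_subset by blast
  have Bl: "finite Bl" "card Bl = (p * (N div (p * M) + 1)) ^ k"
    by (auto simp: Bl_def card_PiE card_cartesian_product intro!: finite_PiE)
  have rng: "y i \<in> {1..N}" if "y \<in> A" "i \<in> {1..k}" for y i
    using A that unfolding grid_def by (blast dest: PiE_mem)
  have ext: "y i = undefined" if "y \<in> A" "i \<notin> {1..k}" for y i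
    using A that unfolding grid_def by (blast dest: PiE_arb)
  have blk_in: "blk y \<in> Bl" if "y \<in> A" for y
    unfolding blk_def Bl_def
  proof (rule restrict_PiE_iff[THEN iffD2], rule ballI)
    fix i assume i: "i \<in> {1..k}"
    have "(y i - 1) div p div M = (y i - 1) div (p * M)" by (simp add: div_mult2_eq)
    also have "\<dots> \<le> N div (p * M)" using rng[OF that i] by (intro div_le_mono) auto
    finally show "((y i - 1) mod p, (y i - 1) div p div M) \<in> {..<p} \<times> {..N div (p * M)}"
      using \<open>p \<ge> 1\<close> by auto
  qed
  have decomp: "y i = 1 + fst (blk y i) + p * (M * snd (blk y i) + (pos y i - 1))"
    if "y \<in> A" "i \<in> {1..k}" for y i
  proof -
    have "p * (M * ((y i - 1) div p div M) + (y i - 1) div p mod M) + (y i - 1) mod p = y i - 1"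
      by (simp add: mult_div_mod_eq)
    then show ?thesis using rng[OF that] that by (auto simp: blk_def pos_def)
  qed
  have "\<exists>b\<in>Bl. max_corner_free k M < card {y \<in> A. blk y = b}"
  proof (rule ccontr)
    assume "\<not> ?thesis"
    then have small: "card {y \<in> A. blk y = b} \<le> max_corner_free k M" if "b \<in> Bl" for b
      using that by (auto simp: not_less)
    have "A = (\<Union>b\<in>Bl. {y \<in> A. blk y = b})" using blk_in by auto
    then have "card A \<le> (\<Sum>b\<in>Bl. card {y \<in> A. blk y = b})"
      using card_UN_le[OF Bl(1), of "\<lambda>b. {y \<in> A. blk y = b}"] by simp
    also have "\<dots> \<le> card Bl * max_corner_free k M"
      using sum_bounded_above[of Bl "\<lambda>b. card {y \<in> A. blk y = b}", OF small] by simp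
    finally show False using big Bl(2) by simp
  qed
  then obtain b where b: "max_corner_free k M < card {y \<in> A. blk y = b}" by blast
  define W where "W = {y \<in> A. blk y = b}"
  have inj: "inj_on pos W"
  proof (rule inj_onI)
    fix y z assume yz: "y \<in> W" "z \<in> W" "pos y = pos z"
    show "y = z"
    proof
      fix i show "y i = z i"
        using yz decomp[of y i] decomp[of z i] ext[of y i] ext[of z i]
        by (cases "i \<in> {1..k}") (simp_all add: W_def)
    qed
  qed
  have "pos ` W \<subseteq> grid k M"
    using \<open>M \<ge> 1\<close> by (auto simp: pos_def grid_def Suc_le_eq)
  moreover have "\<not> corner_free k M (pos ` W)"
    using max_corner_free_ge[of k M "pos ` W"] b card_image[OF inj] by (auto simp: W_def)
  ultimately obtain x d where d: "d > 0" and x: "corner k x d \<subseteq> pos ` W"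
    by (auto simp: corner_free_iff corners_in_def)
  obtain a where a: "a \<in> W" "x = pos a" using x by (auto simp: corner_def)
  \<comment> \<open>Within a block, moving the position by \<open>d\<close> moves the original
    coordinate by \<open>p * d\<close>.\<close>
  have "a(i := a i + p * d) \<in> A" if i: "i \<in> {1..k}" for i
  proof -
    have "x(i := x i + d) \<in> pos ` W" using x i by (auto simp: corner_def)
    then obtain y where y: "y \<in> W" "pos y = x(i := x i + d)" by auto
    have "y = a(i := a i + p * d)"
    proof
      fix l
      show "y l = (a(i := a i + p * d)) l"
      proof (cases "l \<in> {1..k}")
        case False
        then show ?thesis using i ext[of y l] ext[of a l] y(1) a(1) by (auto simp: W_def)
      next
        case True
        have *: "blk y = blk a" "y \<in> A" "a \<in> A" using y(1) a(1) by (auto simp: W_def)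
        have "pos a l \<ge> 1" using True by (simp add: pos_def)
        then obtain t where "pos a l = Suc t" by (cases "pos a l") auto
        then show ?thesis
          using decomp[OF *(2) True] decomp[OF *(3) True] *(1) y(2) a(2)
          by (auto simp: algebra_simps)
      qed
    qed
    then show ?thesis using y by (simp add: W_def)
  qed
  then have "corner k a (p * d) \<subseteq> A" using a by (auto simp: corner_def W_def)
  then have "(a, p * d) \<in> corners_in k A" using d \<open>p \<ge> 1\<close> by (simp add: corners_in_def)
  then show ?thesis by (intro bexI[of _ "(a, p * d)"]) auto
qed

text \<open>While the set exceeds the pigeonhole threshold, delete the apex of a suitable corner:
  each deletion costs one point and destroys at least one such corner.\<close>

lemma card_corners_multiple_difference:
  assumes "A \<subseteq> grid k N" "k \<ge> 1" "p \<ge> 1" "M \<ge> 1"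
  shows "card A \<le> card {c \<in> corners_in k A. p dvd snd c}
    + (p * (N div (p * M) + 1)) ^ k * max_corner_free k M"
proof -
  let ?T = "(p * (N div (p * M) + 1)) ^ k * max_corner_free k M"
  have "finite A" using assms(1) finite_grid finite_subset by blast
  then show ?thesis using assms(1)
  proof (induction A rule: finite_psubset_induct)
    case (psubset A)
    show ?case
    proof (cases "card A \<le> ?T")
      case False
      then obtain a d where c: "(a, d) \<in> corners_in k A" "p dvd d"
        using corner_with_multiple_difference[OF psubset.prems assms(3,4)] by auto
      then have a: "a \<in> A" by (auto simp: corners_in_def corner_def)
      have IH: "card (A - {a}) \<le> card {c \<in> corners_in k (A - {a}). p dvd snd c} + ?T"
        by (rule psubset.IH) (use a psubset.prems in auto)
      have fin: "finite (corners_in k A)" by (rule finite_corners_in[OF psubset.prems assms(2)])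
      have notin: "(a, d) \<notin> corners_in k (A - {a})" by (auto simp: corners_in_def corner_def)
      have sub: "corners_in k (A - {a}) \<subseteq> corners_in k A" by (auto simp: corners_in_def)
      have "{c \<in> corners_in k (A - {a}). p dvd snd c} \<subset> {c \<in> corners_in k A. p dvd snd c}"
        using c notin sub by (intro psubsetI) auto
      then have "card {c \<in> corners_in k (A - {a}). p dvd snd c} < card {c \<in> corners_in k A. p dvd snd c}"
        using fin by (intro psubset_card_mono) auto
      moreover have "card (A - {a}) = card A - 1" using a psubset.hyps by simp
      ultimately show ?thesis using IH by linarith
    qed auto
  qed
qed

text \<open>The product of distinct prime divisors divides \<open>n\<close>, and each factor is at
  least 2.\<close>

lemma card_prime_divisors_le:
  fixes n :: nat
  assumes "0 < n" "n \<le> 2 ^ l" "\<And>p. p \<in> P \<Longrightarrow> prime p"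
  shows "card {p \<in> P. p dvd n} \<le> l"
proof -
  have sub: "{p \<in> P. p dvd n} \<subseteq> prime_factors n"
    using assms by (auto simp: in_prime_factors_iff)
  let ?S = "{p \<in> P. p dvd n}"
  have fin: "finite ?S" using sub finite_subset by blast
  have "(2::nat) ^ card ?S = (\<Prod>p\<in>?S. 2)" by simp
  also have "\<dots> \<le> (\<Prod>p\<in>?S. p)"
    using assms(3) prime_ge_2_nat by (intro prod_mono) auto
  also have "\<dots> \<le> n"
  proof (rule dvd_imp_le[OF _ assms(1)])
    have "(\<Prod>p\<in>?S. p) dvd (\<Prod>p\<in>prime_factors n. p ^ multiplicity p n)"
    proof (rule prod_dvd_prod_subset2[OF _ sub])
      fix p assume "p \<in> ?S"
      then have "p \<in> prime_factors n" using sub by blast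
      then have "multiplicity p n > 0" by (simp add: prime_factors_multiplicity)
      then show "p dvd p ^ multiplicity p n" by simp
    qed simp
    also have "\<dots> = n" using prime_factorization_nat[of n] assms(1) by simp
    finally show "(\<Prod>p\<in>?S. p) dvd n" .
  qed
  also have "\<dots> \<le> 2 ^ l" by (rule assms(2))
  finally show ?thesis by simp
qed

text \<open>For each prime \<open>p \<le> D\<close> the pigeonhole threshold is at most half of
  \<open>card A\<close>, leaving at least \<open>card A / 2\<close> corners with difference
  divisible by \<open>p\<close>. Summing over \<open>p\<close> counts each corner at most
  \<open>l\<close> times, since its difference is at most \<open>2 ^ l\<close>.\<close>

lemma corner_supersaturation:
  assumes A: "A \<subseteq> grid k N" and "k \<ge> 1" "M \<ge> 1" "N \<le> 2 ^ l" "D * M \<le> N"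
    and big: "2 * (2 * N) ^ k * max_corner_free k M \<le> M ^ k * card A"
  shows "card {p::nat. prime p \<and> p \<le> D} * card A \<le> 2 * l * card (corners_in k A)"
proof -
  define P where "P = {p::nat. prime p \<and> p \<le> D}"
  have finP: "finite P" by (rule finite_subset[of _ "{..D}"]) (auto simp: P_def)
  have fin: "finite (corners_in k A)" by (rule finite_corners_in[OF A \<open>k \<ge> 1\<close>])
  have each: "card A \<le> 2 * card {c \<in> corners_in k A. p dvd snd c}" if p: "p \<in> P" for p
  proof -
    have p1: "p \<ge> 1" using p prime_gt_0_nat[of p] by (auto simp: P_def)
    let ?T = "(p * (N div (p * M) + 1)) ^ k * max_corner_free k M"
    \<comment> \<open>Covering \<open>[N]\<close> by full blocks overshoots by at most one block
      length \<open>p * M\<close>, which is at most \<open>D * M\<close>.\<close>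
    have "M * (p * (N div (p * M) + 1)) = (p * M) * (N div (p * M)) + p * M"
      by (simp add: algebra_simps)
    also have "\<dots> \<le> N + D * M"
      using p by (intro add_mono times_div_less_eq_dividend mult_right_mono) (auto simp: P_def)
    also have "\<dots> \<le> 2 * N" using assms(5) by simp
    finally have "(M * (p * (N div (p * M) + 1))) ^ k \<le> (2 * N) ^ k" by (rule power_mono) simp
    then have "2 * ((M * (p * (N div (p * M) + 1))) ^ k * max_corner_free k M)
        \<le> 2 * ((2 * N) ^ k * max_corner_free k M)"
      by (intro mult_left_mono mult_right_mono) auto
    also have "\<dots> \<le> M ^ k * card A" using big by (simp only: mult.assoc)
    also have "2 * ((M * (p * (N div (p * M) + 1))) ^ k * max_corner_free k M) = M ^ k * (2 * ?T)"
      unfolding power_mult_distrib[of M] by (simp only: mult_ac)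
    finally have "M ^ k * (2 * ?T) \<le> M ^ k * card A" .
    then have "2 * ?T \<le> card A" using \<open>M \<ge> 1\<close> by simp
    then show ?thesis
      using card_corners_multiple_difference[OF A \<open>k \<ge> 1\<close> p1 \<open>M \<ge> 1\<close>] by linarith
  qed
  have "card P * card A \<le> (\<Sum>p\<in>P. 2 * card {c \<in> corners_in k A. p dvd snd c})"
    using sum_bounded_below[of P "card A" "\<lambda>p. 2 * card {c \<in> corners_in k A. p dvd snd c}"] each
    by simp
  also have "\<dots> = 2 * (\<Sum>c\<in>corners_in k A. card {p \<in> P. p dvd snd c})"
    unfolding sum_distrib_left[symmetric]
    by (intro arg_cong[where f = "(*) 2"] sum_multicount_gen[OF finP fin]) simp
  also have "\<dots> \<le> 2 * (card (corners_in k A) * l)"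
  proof (intro mult_left_mono)
    have "card {p \<in> P. p dvd snd c} \<le> l" if "c \<in> corners_in k A" for c
      using corners_in_subset[OF A \<open>k \<ge> 1\<close>] that \<open>N \<le> 2 ^ l\<close>
      by (intro card_prime_divisors_le) (auto simp: P_def)
    then show "(\<Sum>c\<in>corners_in k A. card {p \<in> P. p dvd snd c}) \<le> card (corners_in k A) * l"
      using sum_bounded_above[of "corners_in k A" "\<lambda>c. card {p \<in> P. p dvd snd c}" l] by simp
  qed simp
  finally show ?thesis by (simp add: P_def algebra_simps)
qed

section \<open>A dense corner-free set\<close>

lemma digit_sum_inj:
  fixes b :: nat
  assumes "\<And>i. i < n \<Longrightarrow> x i < b" "\<And>i. i < n \<Longrightarrow> y i < b"
    and "(\<Sum>i<n. x i * b ^ i) = (\<Sum>i<n. y i * b ^ i)" "i < n"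
  shows "x i = y i"
  using assms
proof (induction n arbitrary: x y i)
  case (Suc n)
  have shift: "(\<Sum>i<Suc n. z i * b ^ i) = z 0 + b * (\<Sum>i<n. z (Suc i) * b ^ i)" for z
    by (simp only: sum.lessThan_Suc_shift sum_distrib_left) (simp add: algebra_simps)
  have eq: "x 0 + b * (\<Sum>i<n. x (Suc i) * b ^ i) = y 0 + b * (\<Sum>i<n. y (Suc i) * b ^ i)"
    using Suc.prems(3) by (simp only: shift)
  have lt: "x 0 < b" "y 0 < b" using Suc.prems by auto
  have "x 0 = (x 0 + b * (\<Sum>i<n. x (Suc i) * b ^ i)) mod b" using lt by simp
  also have "\<dots> = y 0" unfolding eq using lt by simp
  finally have 0: "x 0 = y 0" .
  then have "(\<Sum>i<n. x (Suc i) * b ^ i) = (\<Sum>i<n. y (Suc i) * b ^ i)" using eq lt by simp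
  then have "x (Suc j) = y (Suc j)" if "j < n" for j
    using Suc.IH[of "\<lambda>i. x (Suc i)" "\<lambda>i. y (Suc i)" j] Suc.prems that by auto
  then show ?case using 0 Suc.prems(4) by (cases i) auto
qed auto

lemma digit_sum_less:
  fixes b q :: nat
  assumes "\<And>i. i < n \<Longrightarrow> x i < q" "q \<le> b" "n \<ge> 1"
  shows "(\<Sum>i<n. x i * b ^ i) < q * b ^ (n - 1)"
  using assms(3,1)
proof (induction n rule: nat_induct_at_least)
  case (Suc n)
  then obtain m where m: "n = Suc m" by (cases n) auto
  have "(\<Sum>i<Suc n. x i * b ^ i) < q * b ^ (n - 1) + x n * b ^ n"
    using Suc by simp
  also have "q * b ^ (n - 1) \<le> b ^ n" using assms(2) m by simp
  also have "b ^ n + x n * b ^ n = Suc (x n) * b ^ n" by simp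
  also have "\<dots> \<le> q * b ^ n" using Suc.prems[of n] by (intro mult_right_mono) auto
  finally show ?case by simp
qed auto

text \<open>Parallelogram identity: the squared distance of \<open>x\<close> and \<open>z\<close> is
  \<open>2 * R + 2 * R - 4 * R\<close>.\<close>

lemma sphere_midpoint:
  fixes x y z :: "nat \<Rightarrow> nat"
  assumes "\<And>i. i < n \<Longrightarrow> x i + z i = 2 * y i"
    and "(\<Sum>i<n. (x i)\<^sup>2) = R" "(\<Sum>i<n. (y i)\<^sup>2) = R" "(\<Sum>i<n. (z i)\<^sup>2) = R" "i < n"
  shows "x i = z i"
proof -
  have "(\<Sum>i<n. (int (x i) - int (z i))\<^sup>2) =
      (\<Sum>i<n. 2 * int ((x i)\<^sup>2) + 2 * int ((z i)\<^sup>2) - 4 * int ((y i)\<^sup>2))"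
  proof (rule sum.cong[OF refl])
    fix i assume "i \<in> {..<n}"
    then have "int (x i) + int (z i) = 2 * int (y i)" using assms(1)[of i] by simp
    then have z: "int (z i) = 2 * int (y i) - int (x i)" by simp
    show "(int (x i) - int (z i))\<^sup>2 = 2 * int ((x i)\<^sup>2) + 2 * int ((z i)\<^sup>2) - 4 * int ((y i)\<^sup>2)"
      unfolding of_nat_power z by (simp add: power2_eq_square algebra_simps)
  qed
  also have "\<dots> = 2 * int (\<Sum>i<n. (x i)\<^sup>2) + 2 * int (\<Sum>i<n. (z i)\<^sup>2) - 4 * int (\<Sum>i<n. (y i)\<^sup>2)"
    by (simp only: sum_subtractf sum.distrib sum_distrib_left of_nat_sum)
  also have "\<dots> = 0" using assms(2-4) by simp
  finally have "\<forall>i\<in>{..<n}. (int (x i) - int (z i))\<^sup>2 = 0"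
    using sum_nonneg_eq_0_iff[of "{..<n}" "\<lambda>i. (int (x i) - int (z i))\<^sup>2"] by simp
  then have "(int (x i) - int (z i))\<^sup>2 = 0" using assms(5) by blast
  then show ?thesis by simp
qed

text \<open>The set consists of numbers with \<open>u\<close> digits in base
  \<open>b = 2 ^ u\<close> whose digit vectors lie on one sphere, the most popular one. Digits stay
  below \<open>q = b / 4\<close>, so adding two such numbers causes no carries and a progression
  would give a midpoint on the sphere.\<close>

lemma behrend:
  assumes "u \<ge> 2"
  obtains S :: "nat set" where "S \<subseteq> {..<2 ^ (u\<^sup>2 - 2)}" "2 ^ (u\<^sup>2) \<le> 2 ^ (5 * u) * card S"
    "\<And>s d. s \<in> S \<Longrightarrow> s + d \<in> S \<Longrightarrow> s + 2 * d \<in> S \<Longrightarrow> d = 0"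
proof -
  define b q :: nat where "b = 2 ^ u" and "q = 2 ^ (u - 2)"
  have "(2::nat) ^ u = 2 ^ (2 + (u - 2))" using assms by (intro arg_cong[where f = "(^) 2"]) simp
  then have b4: "b = 4 * q" by (simp only: b_def q_def power_add) simp
  have q: "q \<ge> 1" by (simp add: q_def)
  define X where "X = ({..<u} \<rightarrow>\<^sub>E {..<q})"
  have X: "finite X" "card X = q ^ u" by (auto simp: X_def card_PiE intro!: finite_PiE)
  have dig: "x i < q" if "x \<in> X" "i < u" for x i using that by (auto simp: X_def)
  define R where "R x = (\<Sum>i<u. (x i)\<^sup>2)" for x :: "nat \<Rightarrow> nat"
  have Rle: "R x \<le> u * q\<^sup>2" if "x \<in> X" for x
  proof -
    have "R x \<le> (\<Sum>i<u. q\<^sup>2)" unfolding R_def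
      using dig[OF that] by (intro sum_mono power_mono) (auto intro: less_imp_le)
    then show ?thesis by simp
  qed
  have "\<exists>r. card X \<le> (u * q\<^sup>2 + 1) * card {x \<in> X. R x = r}"
  proof (rule ccontr)
    assume "\<not> ?thesis"
    then have small: "(u * q\<^sup>2 + 1) * card {x \<in> X. R x = r} < card X" for r
      by (auto simp: not_le)
    have "X = (\<Union>r\<le>u * q\<^sup>2. {x \<in> X. R x = r})" using Rle by auto
    then have "card X \<le> (\<Sum>r\<le>u * q\<^sup>2. card {x \<in> X. R x = r})"
      using card_UN_le[of "{..u * q\<^sup>2}" "\<lambda>r. {x \<in> X. R x = r}"] by simp
    then have "(u * q\<^sup>2 + 1) * card X \<le> (\<Sum>r\<le>u * q\<^sup>2. (u * q\<^sup>2 + 1) * card {x \<in> X. R x = r})"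
      unfolding sum_distrib_left[symmetric] by (rule mult_left_mono) simp
    also have "\<dots> < (\<Sum>r\<le>u * q\<^sup>2. card X)" using small by (intro sum_strict_mono) auto
    finally show False by simp
  qed
  then obtain r where r: "card X \<le> (u * q\<^sup>2 + 1) * card {x \<in> X. R x = r}" by blast
  define W where "W = {x \<in> X. R x = r}"
  define enc where "enc x = (\<Sum>i<u. x i * b ^ i)" for x :: "nat \<Rightarrow> nat"
  define S where "S = enc ` W"
  have inj: "inj_on enc W"
  proof (rule inj_onI)
    fix x y assume xy: "x \<in> W" "y \<in> W" "enc x = enc y"
    have "x i = y i" if "i < u" for i
    proof (rule digit_sum_inj[where b = b and n = u and x = x and y = y])
      show "x i < b" "y i < b" if "i < u" for i
        using dig[of x i] dig[of y i] xy that b4 by (auto simp: W_def)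
    qed (use xy that in \<open>auto simp: enc_def\<close>)
    then show "x = y" using xy by (intro PiE_ext[of x "{..<u}" _ y]) (auto simp: W_def X_def)
  qed
  have "S \<subseteq> {..<2 ^ (u\<^sup>2 - 2)}"
  proof -
    have "enc x < 2 ^ (u\<^sup>2 - 2)" if "x \<in> W" for x
    proof -
      \<comment> \<open>The small leading digit keeps the set within a quarter of
        \<open>2 ^ (u\<^sup>2)\<close>, room that the corner construction uses.\<close>
      have "enc x < q * b ^ (u - 1)" unfolding enc_def
        using that assms b4 by (intro digit_sum_less) (auto simp: W_def dig)
      also have "\<dots> = 2 ^ (u - 2 + u * (u - 1))" by (simp add: q_def b_def power_add power_mult)
      also have "u - 2 + u * (u - 1) = u\<^sup>2 - 2"
        using assms by (cases u) (auto simp: power2_eq_square)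
      finally show ?thesis .
    qed
    then show ?thesis by (auto simp: S_def)
  qed
  moreover have "2 ^ (u\<^sup>2) \<le> 2 ^ (5 * u) * card S"
  proof -
    have "u * q\<^sup>2 + 1 \<le> 2 ^ (3 * u)"
    proof -
      have "u * q\<^sup>2 + 1 \<le> Suc u * q\<^sup>2" using one_le_power[OF q, of 2] by simp
      also have "\<dots> \<le> 2 ^ u * q\<^sup>2" using less_exp[of u] by (intro mult_right_mono) (auto simp: Suc_le_eq)
      also have "\<dots> \<le> 2 ^ u * b\<^sup>2" using b4 by (intro mult_left_mono power_mono) auto
      also have "\<dots> = 2 ^ (3 * u)"
        by (simp add: b_def power_mult[symmetric] power_add[symmetric] mult.commute)
      finally show ?thesis .
    qed
    have "(2::nat) ^ (u\<^sup>2) = 2 ^ (2 * u) * q ^ u"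
      using assms by (simp add: q_def power_mult[symmetric] power_add[symmetric] power2_eq_square)
        (simp add: algebra_simps)
    also have "\<dots> \<le> 2 ^ (2 * u) * ((u * q\<^sup>2 + 1) * card W)"
      using r X(2) by (simp add: W_def)
    also have "\<dots> \<le> 2 ^ (2 * u) * (2 ^ (3 * u) * card W)"
      using \<open>u * q\<^sup>2 + 1 \<le> 2 ^ (3 * u)\<close> by (intro mult_left_mono mult_right_mono) auto
    also have "\<dots> = 2 ^ (5 * u) * card S"
      by (simp add: S_def card_image[OF inj] power_add[symmetric] flip: mult.assoc)
    finally show ?thesis .
  qed
  moreover have "d = 0" if sd: "s \<in> S" "s + d \<in> S" "s + 2 * d \<in> S" for s d
  proof -
    obtain x y z where xyz: "x \<in> W" "y \<in> W" "z \<in> W" "enc x = s" "enc y = s + d" "enc z = s + 2 * d"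
      using sd by (auto simp: S_def)
    have "x i + z i = 2 * y i" if "i < u" for i
    proof (rule digit_sum_inj[where b = b and n = u and x = "\<lambda>i. x i + z i" and y = "\<lambda>i. 2 * y i"])
      show "x i + z i < b" "2 * y i < b" if "i < u" for i
        using dig[of x i] dig[of y i] dig[of z i] xyz that b4 by (auto simp: W_def)
      show "(\<Sum>i<u. (x i + z i) * b ^ i) = (\<Sum>i<u. 2 * y i * b ^ i)"
        using xyz(4-6) unfolding enc_def
        by (simp add: distrib_right sum.distrib mult.assoc sum_distrib_left[symmetric])
    qed (use that in auto)
    then have "x i = z i" if "i < u" for i
      by (rule sphere_midpoint[where R = r and n = u and y = y])
        (use xyz(1-3) that in \<open>auto simp: W_def R_def\<close>)
    then have "enc x = enc z" by (simp add: enc_def)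
    then show "d = 0" using xyz by simp
  qed
  ultimately show ?thesis using that by blast
qed

text \<open>The values of \<open>a\<^sub>1 + 2a\<^sub>2\<close> at \<open>a\<close>, \<open>a + d e\<^sub>1\<close>, \<open>a + d e\<^sub>2\<close> form a progression of
  length three.\<close>
lemma max_corner_free_lower_bound:
  assumes "u \<ge> 2" "k \<ge> 2"
  shows "(2 ^ (u\<^sup>2)) ^ k \<le> 2 ^ (7 * u) * max_corner_free k (2 ^ (u\<^sup>2))"
proof -
  obtain S :: "nat set" where S: "S \<subseteq> {..<2 ^ (u\<^sup>2 - 2)}" "2 ^ (u\<^sup>2) \<le> 2 ^ (5 * u) * card S"
    "\<And>s d. s \<in> S \<Longrightarrow> s + d \<in> S \<Longrightarrow> s + 2 * d \<in> S \<Longrightarrow> d = 0"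
    using behrend[OF assms(1)] by blast
  define n where "n = (2::nat) ^ (u\<^sup>2 - 2)"
  define N where "N = (2::nat) ^ (u\<^sup>2)"
  have "u\<^sup>2 \<ge> 2\<^sup>2" using assms(1) by (intro power_mono) auto
  then have "(2::nat) ^ (u\<^sup>2) = 2 ^ (2 + (u\<^sup>2 - 2))" by (intro arg_cong[where f = "(^) 2"]) simp
  then have N: "N = 4 * n" by (simp only: N_def n_def power_add) simp
  have n: "n \<ge> 1" by (simp add: n_def)
  \<comment> \<open>The shift \<open>3 * n\<close> makes \<open>a 1 = s + 3 * n - 2 * y\<close> lie
    in \<open>{1..N}\<close> for every \<open>s < n\<close> and every \<open>a 2 = y\<close> in
    \<open>{1..n}\<close>.\<close>
  define A where "A = {a \<in> grid k N. \<exists>s\<in>S. a 1 + 2 * a 2 = s + 3 * n}"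
  have "corners_in k A = {}"
  proof (rule ccontr)
    assume "corners_in k A \<noteq> {}"
    then obtain a d where d: "d > 0" "corner k a d \<subseteq> A" by (auto simp: corners_in_def)
    have "a \<in> A" using d(2) by (auto simp: corner_def)
    moreover have "a(i := a i + d) \<in> A" if "i \<in> {1..k}" for i
      using d(2) that by (auto simp: corner_def)
    from this[of 1] this[of 2] have "a(1 := a 1 + d) \<in> A" "a(2 := a 2 + d) \<in> A"
      using assms(2) by auto
    ultimately have "a \<in> A" "a(1 := a 1 + d) \<in> A" "a(2 := a 2 + d) \<in> A" by auto
    then obtain s s1 s2 where s: "s \<in> S" "s1 \<in> S" "s2 \<in> S" "a 1 + 2 * a 2 = s + 3 * n"
       "a 1 + d + 2 * a 2 = s1 + 3 * n" "a 1 + 2 * (a 2 + d) = s2 + 3 * n"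
      by (auto simp: A_def)
    have "s1 = s + d" "s2 = s + 2 * d" using s(4-6) by auto
    then show False using S(3)[of s d] s(1-3) d(1) by simp
  qed
  then have cf: "corner_free k N A" by (auto simp: corner_free_iff A_def)
  \<comment> \<open>Choosing \<open>s\<close>, the second coordinate in \<open>{1..n}\<close> and
    all coordinates from the third on freely determines the first one.\<close>
  define g where "g = (\<lambda>(s, y, f :: nat \<Rightarrow> nat). \<lambda>i\<in>{1..k}. if i = 1 then s + 3 * n - 2 * y else if i = 2 then y else f i)"
  define T where "T = S \<times> {1..n} \<times> ({3..k} \<rightarrow>\<^sub>E {1..N})"
  have "g ` T \<subseteq> A"
  proof
    fix a assume "a \<in> g ` T"
    then obtain s y f where syf: "s \<in> S" "y \<in> {1..n}" "f \<in> {3..k} \<rightarrow>\<^sub>E {1..N}" "a = g (s, y, f)"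
      by (auto simp: T_def)
    have sn: "s < n" using S(1) syf(1) by (auto simp: n_def)
    have f: "f i \<in> {1..N}" if "i \<in> {3..k}" for i using syf(3) that by (rule PiE_mem)
    have "a \<in> grid k N"
      unfolding grid_def syf(4) g_def prod.case
    proof (rule restrict_PiE_iff[THEN iffD2], rule ballI)
      fix i assume i: "i \<in> {1..k}"
      consider "i = 1" | "i = 2" | "i \<in> {3..k}" using i by fastforce
      then show "(if i = 1 then s + 3 * n - 2 * y else if i = 2 then y else f i) \<in> {1..N}"
        using syf(2) sn N n f[of i] by cases auto
    qed
    moreover have "a 1 + 2 * a 2 = s + 3 * n"
      using syf(2) assms(2) sn by (auto simp: syf(4) g_def)
    ultimately show "a \<in> A" using syf(1) by (auto simp: A_def)
  qed
  moreover have "inj_on g T"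
  proof (rule inj_onI)
    fix t t' assume tt: "t \<in> T" "t' \<in> T" "g t = g t'"
    obtain s y f where t: "t = (s, y, f)" by (cases t)
    obtain s' y' f' where t': "t' = (s', y', f')" by (cases t')
    have eq: "g t i = g t' i" for i using tt(3) by simp
    have y: "y = y'" using eq[of 2] assms(2) by (simp add: t t' g_def)
    have "s = s'" using eq[of 1] assms(2) y tt(1,2) by (auto simp: t t' g_def T_def)
    moreover have "f = f'"
    proof (rule PiE_ext)
      show "f \<in> {3..k} \<rightarrow>\<^sub>E {1..N}" "f' \<in> {3..k} \<rightarrow>\<^sub>E {1..N}"
        using tt(1,2) by (auto simp: t t' T_def)
      show "f i = f' i" if "i \<in> {3..k}" for i
        using eq[of i] that by (auto simp: t t' g_def split: if_splits)
    qed
    ultimately show "t = t'" using y by (simp add: t t')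
  qed
  moreover have "finite A" using finite_grid[of k N] by (simp add: A_def)
  ultimately have "card T \<le> card A" by (metis card_image card_mono)
  also have "\<dots> \<le> max_corner_free k N" by (rule max_corner_free_ge[OF cf])
  finally have T: "card T \<le> max_corner_free k N" .
  have cT: "card T = card S * (n * N ^ (k - 2))"
    unfolding T_def by (simp add: card_cartesian_product card_PiE)
  have "N ^ k = N * (N * N ^ (k - 2))"
    using assms(2) by (metis power_add power2_eq_square mult.assoc le_add_diff_inverse)
  also have "\<dots> \<le> (2 ^ (5 * u) * card S) * (4 * n * N ^ (k - 2))"
    using S(2) N unfolding N_def[symmetric] by (intro mult_mono) auto
  also have "\<dots> = 2 ^ (5 * u) * 4 * card T" unfolding cT by (simp only: mult_ac)
  also have "\<dots> \<le> 2 ^ (5 * u) * 2 ^ (2 * u) * max_corner_free k N"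
  proof (intro mult_mono T)
    have "(4::nat) = 2 ^ 2" by simp
    also have "\<dots> \<le> 2 ^ (2 * u)" using assms(1) by (intro power_increasing) auto
    finally show "(4::nat) \<le> 2 ^ (2 * u)" .
  qed auto
  also have "\<dots> = 2 ^ (7 * u) * max_corner_free k N" by (simp add: power_add[symmetric])
  finally show ?thesis by (simp add: N_def)
qed

section \<open>Counting corner-free sets\<close>

text \<open>Supersaturation, thinning to bounded degree, containers and iteration combined.
  \<open>M\<close> is the smaller scale, \<open>m\<close> the size from which supersaturation
  applies, \<open>2 * d\<close> the guaranteed ratio of corners to points, and \<open>\<tau>\<close>
  the proportion of points queried.\<close>

lemma corner_free_count_bound:
  fixes k :: nat
  assumes "k \<ge> 2"
  obtains c :: real where "c > 0"
    "\<And>N M D l m d \<tau>. M \<ge> 1 \<Longrightarrow> l > 0 \<Longrightarrow> N \<le> 2 ^ l \<Longrightarrow> D * M \<le> N \<Longrightarrow> d \<ge> 1 \<Longrightarrow>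
      4 * real l * d \<le> real (card {p::nat. prime p \<and> p \<le> D}) \<Longrightarrow> m > 0 \<Longrightarrow>
      2 * (2 * N) ^ k * max_corner_free k M \<le> M ^ k * m \<Longrightarrow>
      \<tau> > 0 \<Longrightarrow> 2 * \<tau> \<le> c \<Longrightarrow> real ((k + 1)\<^sup>2) \<le> d * (\<tau> / 4) ^ k \<Longrightarrow> 1 \<le> \<tau> * (2 * real m) \<Longrightarrow>
      real (card {A. corner_free k N A})
        \<le> (real (N ^ k) + 1) powr (2 * \<tau> * real k / c * real (N ^ k)) * 2 ^ (2 * m)"
proof -
  define \<phi> where "\<phi> = (\<lambda>i. corner k (fst i) (snd i))"
  \<comment> \<open>Thinned families have degrees at most \<open>2 * (k + 1) * d + 1\<close>, hence
    at most \<open>?K * d\<close> as \<open>d \<ge> 1\<close>; \<open>?B\<close> is the codegree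
    bound.\<close>
  let ?K = "2 * real k + 3" and ?B = "real ((k + 1)\<^sup>2)"
  obtain c where c: "c > 0" and cont: "\<And>(A :: (nat \<Rightarrow> nat) set) (J :: ((nat \<Rightarrow> nat) \<times> nat) set) \<phi> d s.
      d > 0 \<Longrightarrow> bounded_hypergraph (Suc k) (?K * d) ?B A J \<phi> \<Longrightarrow> d * real (card A) \<le> real (card J) \<Longrightarrow>
      real s \<le> c * real (card A) \<Longrightarrow> ?B \<le> d * (real s / (4 * real (card A))) ^ k \<Longrightarrow>
      \<exists>\<Z>. avoided_family c A J \<phi> ((card A + 1) ^ (s * k)) \<Z>"
    using container_family[of ?K ?B k, where 'a = "nat \<Rightarrow> nat" and 'i = "(nat \<Rightarrow> nat) \<times> nat"] by auto
  have "real (card {A. corner_free k N A})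
        \<le> (real (N ^ k) + 1) powr (2 * \<tau> * real k / c * real (N ^ k)) * 2 ^ (2 * m)"
    if M: "M \<ge> 1" and l: "l > 0" "N \<le> 2 ^ l" and D: "D * M \<le> N" and d: "d \<ge> 1"
      and primes: "4 * real l * d \<le> real (card {p::nat. prime p \<and> p \<le> D})" and m: "m > 0"
        "2 * (2 * N) ^ k * max_corner_free k M \<le> M ^ k * m"
      and \<tau>: "\<tau> > 0" "2 * \<tau> \<le> c" "?B \<le> d * (\<tau> / 4) ^ k" "1 \<le> \<tau> * (2 * real m)"
    for N M D l m d \<tau>
  proof -
    have k1: "k \<ge> 1" using assms by simp
    define V where "V = grid k N"
    have finV: "finite V" by (simp add: V_def finite_grid)
    define J where "J = corners_in k V"
    have finJ: "finite J" unfolding J_def V_def by (rule finite_corners_in) (use k1 in auto)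
    have Jin: "{i \<in> J. \<phi> i \<subseteq> A} = corners_in k A" if "A \<subseteq> V" for A
      using that by (auto simp: J_def \<phi>_def corners_in_def)
    have supersat: "2 * d * real (card A) \<le> real (card (corners_in k A))" if A: "A \<subseteq> V" "m \<le> card A" for A
    proof -
      have "M ^ k * m \<le> M ^ k * card A" using A(2) by simp
      then have "2 * (2 * N) ^ k * max_corner_free k M \<le> M ^ k * card A"
        using m(2) by (rule order_trans[rotated])
      with A(1) have "card {p::nat. prime p \<and> p \<le> D} * card A \<le> 2 * l * card (corners_in k A)"
        unfolding V_def by (rule corner_supersaturation[OF _ k1 M l(2) D])
      then have "real (card {p::nat. prime p \<and> p \<le> D} * card A) \<le> real (2 * l * card (corners_in k A))"
        by (simp only: of_nat_le_iff)
      moreover have "4 * real l * d * real (card A) \<le> real (card {p::nat. prime p \<and> p \<le> D}) * real (card A)"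
        using primes by (rule mult_right_mono) simp
      ultimately have "(2 * real l) * (2 * d * real (card A)) \<le> (2 * real l) * real (card (corners_in k A))"
        by (simp add: mult_ac)
      then show ?thesis using l(1) by simp
    qed
    have "real (card {I. I \<subseteq> V \<and> corners_in k I = {}})
        \<le> (real (card V) + 1) powr ((2 * \<tau> * real k / c) * real (card V)) * 2 ^ (2 * m)"
    proof (rule card_independent_le[OF finV c])
      \<comment> \<open>The threshold is \<open>2 * m\<close> because thinning needs supersaturation
        for subsets of half the size as well.\<close>
      fix A assume A: "A \<subseteq> V" "2 * m \<le> card A"
      define a where "a = real (card A)"
      have finA: "finite A" using A(1) finV finite_subset by blast
      have a: "a \<ge> 2 * real m" "a > 0" using A(2) m(1) by (auto simp: a_def)
      have "\<exists>F\<subseteq>{i \<in> J. \<phi> i \<subseteq> A}. d * real (card A) \<le> real (card F) \<and>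
          (\<forall>v. real (card {i \<in> F. v \<in> \<phi> i}) \<le> 2 * real (Suc k) * d + 1)"
      proof (rule bounded_degree_subfamily[OF finA finJ])
        show "card (\<phi> i) = Suc k" if "i \<in> J" for i
          using that card_corner[of "snd i" k "fst i"] by (auto simp: J_def \<phi>_def corners_in_def)
        fix A' assume A': "A' \<subseteq> A" "card A \<le> 2 * card A'"
        then have "2 * d * real (card A') \<le> real (card (corners_in k A'))"
          using A by (intro supersat) auto
        then show "2 * d * real (card A') \<le> real (card {i \<in> J. \<phi> i \<subseteq> A'})"
          using Jin[of A'] A' A by simp
      qed (use d in auto)
      then obtain F where F: "F \<subseteq> {i \<in> J. \<phi> i \<subseteq> A}" "d * real (card A) \<le> real (card F)"
        "\<And>v. real (card {i \<in> F. v \<in> \<phi> i}) \<le> 2 * real (Suc k) * d + 1" by blast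
      have "2 * real (Suc k) * d + 1 \<le> ?K * d" using d by (simp add: algebra_simps)
      then have deg: "real (card {i \<in> F. v \<in> \<phi> i}) \<le> ?K * d" for v
        using F(3)[of v] by linarith
      have H: "bounded_hypergraph (Suc k) (?K * d) ?B A F \<phi>"
        unfolding bounded_hypergraph_def
      proof (intro conjI ballI allI impI)
        show "finite F" using F(1) finJ by (auto intro: finite_subset)
        show "\<phi> i \<subseteq> A" if "i \<in> F" for i using F(1) that by blast
        show "card (\<phi> i) = Suc k" if "i \<in> F" for i
          using that F(1) card_corner[of "snd i" k "fst i"] by (auto simp: J_def \<phi>_def corners_in_def)
        show "real (card {i \<in> F. u \<in> \<phi> i \<and> v \<in> \<phi> i}) \<le> ?B" if "u \<noteq> v" for u v
        proof -
          have "card {i \<in> F. u \<in> \<phi> i \<and> v \<in> \<phi> i}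
              \<le> card {i \<in> J. u \<in> corner k (fst i) (snd i) \<and> v \<in> corner k (fst i) (snd i)}"
            using F(1) finJ by (intro card_mono) (auto simp: \<phi>_def)
          also have "\<dots> \<le> (k + 1)\<^sup>2" unfolding J_def by (rule card_corners_through_pair[OF that])
          finally show ?thesis by (rule of_nat_mono)
        qed
      qed (use finA deg in auto)
      \<comment> \<open>Rounding up at most doubles \<open>\<tau> * a\<close>, which is at least
        1.\<close>
      define s where "s = nat \<lceil>\<tau> * a\<rceil>"
      have "1 \<le> \<tau> * a" using \<tau>(1,4) a mult_left_mono[of "2 * real m" a \<tau>] by linarith
      then have s: "\<tau> * a \<le> real s" "real s \<le> 2 * \<tau> * a" unfolding s_def by linarith+
      have "\<exists>\<Z>. avoided_family c A F \<phi> ((card A + 1) ^ (s * k)) \<Z>"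
      proof (rule cont[OF _ H F(2)])
        show "real s \<le> c * real (card A)"
          using order_trans[OF s(2) mult_right_mono[OF \<tau>(2)]] a by (simp add: a_def)
        have "\<tau> / 4 \<le> real s / (4 * real (card A))"
          using s(1) a by (simp add: a_def field_simps)
        then have "d * (\<tau> / 4) ^ k \<le> d * (real s / (4 * real (card A))) ^ k"
          using \<tau>(1) d by (intro mult_left_mono power_mono) auto
        then show "?B \<le> d * (real s / (4 * real (card A))) ^ k" using \<tau>(3) by linarith
      qed (use d in auto)
      then obtain \<Z> where \<Z>: "finite \<Z>" "card \<Z> \<le> (card A + 1) ^ (s * k)"
        "\<forall>Z\<in>\<Z>. Z \<subseteq> A \<and> c * real (card A) \<le> real (card Z)"
        "\<And>I. I \<subseteq> A \<Longrightarrow> \<forall>i\<in>F. \<not> \<phi> i \<subseteq> I \<Longrightarrow> \<exists>Z\<in>\<Z>. Z \<inter> I = {}"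
        unfolding avoided_family_def by blast
      have "real (card \<Z>) \<le> real ((card A + 1) ^ (s * k))" using \<Z>(2) by (simp only: of_nat_le_iff)
      also have "\<dots> = (real (card A) + 1) ^ (s * k)" by (simp add: add.commute)
      also have "\<dots> \<le> (real (card V) + 1) ^ (s * k)"
        using card_mono[OF finV A(1)] by (intro power_mono) auto
      also have "\<dots> = (real (card V) + 1) powr real (s * k)" by (rule powr_realpow[symmetric]) simp
      also have "\<dots> \<le> (real (card V) + 1) powr (c * (2 * \<tau> * real k / c) * real (card A))"
      proof (rule powr_mono)
        have "real s * real k \<le> (2 * \<tau> * a) * real k" using s(2) by (rule mult_right_mono) simp
        then show "real (s * k) \<le> c * (2 * \<tau> * real k / c) * real (card A)"
          using c by (simp add: a_def mult_ac)
      qed simp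
      finally have "real (card \<Z>) \<le> (real (card V) + 1) powr (c * (2 * \<tau> * real k / c) * real (card A))" .
      moreover have "\<exists>Z\<in>\<Z>. Z \<inter> I = {}" if "I \<subseteq> A" "corners_in k I = {}" for I
      proof (rule \<Z>(4)[OF that(1)], rule ballI)
        fix i assume "i \<in> F"
        then have "0 < snd i" using F(1) by (auto simp: J_def corners_in_def)
        then have "i \<in> corners_in k I" if "\<phi> i \<subseteq> I"
          using that by (cases i) (simp add: \<phi>_def corners_in_def)
        then show "\<not> \<phi> i \<subseteq> I" using that(2) by blast
      qed
      ultimately show "\<exists>\<Z>. finite \<Z> \<and>
          real (card \<Z>) \<le> (real (card V) + 1) powr (c * (2 * \<tau> * real k / c) * real (card A)) \<and>
          (\<forall>Z\<in>\<Z>. Z \<subseteq> A \<and> c * real (card A) \<le> real (card Z)) \<and>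
          (\<forall>I\<subseteq>A. corners_in k I = {} \<longrightarrow> (\<exists>Z\<in>\<Z>. Z \<inter> I = {}))"
        using \<Z>(1,3) by blast
    qed (use \<tau> c m in auto)
    then show ?thesis by (simp add: corner_free_iff V_def card_grid)
  qed
  then show thesis using c that by blast
qed

text \<open>If every step from some \<open>t0\<close> on lost a factor of at least
  \<open>2 ^ (e + 1)\<close>, then \<open>f\<close> would eventually fall below its lower bound
  \<open>2 ^ (- e * t)\<close>.\<close>

lemma infinite_slow_decay:
  fixes f :: "nat \<Rightarrow> real"
  assumes "\<And>t. t \<ge> 1 \<Longrightarrow> f t \<le> 1" "\<And>t. t \<ge> 1 \<Longrightarrow> 1 \<le> 2 ^ (e * t) * f t"
  shows "infinite {t. f t \<le> 2 ^ (e + 1) * f (t + 1)}"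
proof
  assume "finite {t. f t \<le> 2 ^ (e + 1) * f (t + 1)}"
  then obtain b where b: "\<And>t. f t \<le> 2 ^ (e + 1) * f (t + 1) \<Longrightarrow> t \<le> b"
    using finite_nat_set_iff_bounded_le by auto
  define t0 where "t0 = Suc b"
  have step: "2 ^ (e + 1) * f (t + 1) \<le> f t" if "t0 \<le> t" for t
    using b[of t] that by (fastforce simp: t0_def)
  have iter: "2 ^ ((e + 1) * j) * f (t0 + j) \<le> 1" for j
  proof (induction j)
    case 0
    then show ?case using assms(1)[of t0] by (simp add: t0_def)
  next
    case (Suc j)
    have "2 ^ ((e + 1) * Suc j) * f (t0 + Suc j) = 2 ^ ((e + 1) * j) * (2 ^ (e + 1) * f (t0 + j + 1))"
      by (simp add: power_add)
    also have "\<dots> \<le> 2 ^ ((e + 1) * j) * f (t0 + j)"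
      using step[of "t0 + j"] by (intro mult_left_mono) auto
    finally show ?case using Suc by linarith
  qed
  \<comment> \<open>Chosen so that \<open>e * (t0 + j) < (e + 1) * j\<close>.\<close>
  define j where "j = Suc (e * t0)"
  have "1 \<le> 2 ^ (e * (t0 + j)) * f (t0 + j)" by (rule assms(2)) (simp add: t0_def)
  moreover from this have pos: "f (t0 + j) > 0"
    by (smt (verit) mult_nonneg_nonpos zero_le_power)
  moreover have "(2::real) ^ (e * (t0 + j)) < 2 ^ ((e + 1) * j)"
    by (rule power_strict_increasing) (auto simp: j_def algebra_simps)
  ultimately have "1 < 2 ^ ((e + 1) * j) * f (t0 + j)"
    using mult_strict_right_mono[of "2 ^ (e * (t0 + j))" "2 ^ ((e + 1) * j)" "f (t0 + j)"] by linarith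
  then show False using iter[of j] by linarith
qed

section \<open>Asymptotic estimates and the choice of parameters\<close>

lemma power_le_exp2:
  fixes C :: real
  obtains u0 :: nat where "\<And>u. u \<ge> u0 \<Longrightarrow> C * real u ^ n \<le> 2 ^ u"
proof -
  have lim: "((\<lambda>x::real. x ^ n / exp x) \<longlongrightarrow> 0) at_top" by (rule tendsto_power_div_exp_0)
  have "filterlim (\<lambda>u. ln 2 * real u) at_top sequentially"
    by (rule filterlim_tendsto_pos_mult_at_top[OF tendsto_const _ filterlim_real_sequentially]) simp
  from filterlim_compose[OF lim this]
  have "(\<lambda>u. (ln 2 * real u) ^ n / exp (ln 2 * real u)) \<longlonglongrightarrow> 0" .
  moreover have "exp (ln 2 * real u) = 2 ^ u" for u
    by (metis exp_ln exp_of_nat_mult mult.commute zero_less_numeral)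
  ultimately have lim2: "(\<lambda>u. (ln 2 * real u) ^ n / 2 ^ u) \<longlonglongrightarrow> 0" by simp
  define \<epsilon> where "\<epsilon> = ln 2 ^ n / (\<bar>C\<bar> + 1)"
  have ln2: "(ln 2 :: real) > 0" by simp
  then have "\<epsilon> > 0" by (simp add: \<epsilon>_def)
  then have "eventually (\<lambda>u. (ln 2 * real u) ^ n / 2 ^ u < \<epsilon>) sequentially"
    using lim2 by (rule order_tendstoD(2)[rotated])
  then obtain u0 where u0: "\<And>u. u \<ge> u0 \<Longrightarrow> (ln 2 * real u) ^ n / 2 ^ u < \<epsilon>"
    by (auto simp: eventually_sequentially)
  have "C * real u ^ n \<le> 2 ^ u" if "u \<ge> u0" for u
  proof -
    have "ln 2 ^ n * real u ^ n < ln 2 ^ n / (\<bar>C\<bar> + 1) * 2 ^ u"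
      using u0[OF that] by (simp add: \<epsilon>_def field_simps power_mult_distrib)
    then have "ln 2 ^ n * ((\<bar>C\<bar> + 1) * real u ^ n) < ln 2 ^ n * 2 ^ u"
      by (simp add: field_simps)
    then have "(\<bar>C\<bar> + 1) * real u ^ n < 2 ^ u" using ln2 by simp
    moreover have "C * real u ^ n \<le> (\<bar>C\<bar> + 1) * real u ^ n" by (intro mult_right_mono) auto
    ultimately show ?thesis by linarith
  qed
  then show thesis using that by blast
qed

lemma max_corner_free_le: "max_corner_free k N \<le> N ^ k"
proof -
  obtain A where A: "corner_free k N A" "card A = max_corner_free k N"
    using max_corner_free_attained by blast
  have "card A \<le> card (grid k N)"
    using A(1) by (intro card_mono finite_grid) (auto simp: corner_free_def)
  then show ?thesis using A(2) by (simp add: card_grid)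
qed

theorem theorem3:
  fixes k :: nat
  assumes "k \<ge> 2"
  shows "\<exists>C::real. C > 0 \<and>
    infinite {N::nat. N > 0 \<and>
      real (card {A. corner_free k N A}) \<le> 2 powr (C * real (max_corner_free k N))}"
proof -
  obtain c :: real where c: "c > 0" and count: "\<And>N M D l m d \<tau>.
      M \<ge> 1 \<Longrightarrow> l > 0 \<Longrightarrow> N \<le> 2 ^ l \<Longrightarrow> D * M \<le> N \<Longrightarrow> d \<ge> 1 \<Longrightarrow>
      4 * real l * d \<le> real (card {p::nat. prime p \<and> p \<le> D}) \<Longrightarrow> m > 0 \<Longrightarrow>
      2 * (2 * N) ^ k * max_corner_free k M \<le> M ^ k * m \<Longrightarrow>
      \<tau> > 0 \<Longrightarrow> 2 * \<tau> \<le> c \<Longrightarrow> real ((k + 1)\<^sup>2) \<le> d * (\<tau> / 4) ^ k \<Longrightarrow> 1 \<le> \<tau> * (2 * real m) \<Longrightarrow>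
      real (card {A. corner_free k N A})
        \<le> (real (N ^ k) + 1) powr (2 * \<tau> * real k / c * real (N ^ k)) * 2 ^ (2 * m)"
    by (rule corner_free_count_bound[OF assms]) blast
  \<comment> \<open>With \<open>u = h * (t + 1)\<close>, consecutive scales have ratio
    \<open>2 ^ (2 * h * u) = 2 ^ (8 * k * u)\<close> up to a constant factor. The
    \<open>k\<close>-th power of the inverse density is at most \<open>2 ^ (7 * k * u)\<close>; the
    spare factor \<open>2 ^ (k * u)\<close> beats polynomials in \<open>u\<close>.\<close>
  define h where "h = 4 * k"
  define \<N> where "\<N> t = (2::nat) ^ ((h * t)\<^sup>2)" for t
  define \<delta> where "\<delta> t = real (max_corner_free k (\<N> t)) / real (\<N> t ^ k)" for t
  have \<N>pos: "\<N> t \<ge> 1" for t by (simp add: \<N>_def)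
  have \<delta>1: "\<delta> t \<le> 1" for t
    using max_corner_free_le[of k "\<N> t"] \<N>pos[of t] unfolding \<delta>_def
    by (simp add: divide_le_eq_1 flip: of_nat_power)
  have \<delta>low: "1 \<le> 2 ^ (7 * h * t) * \<delta> t" if "t \<ge> 1" for t
  proof -
    have "4 * 2 * 1 \<le> h * t" unfolding h_def using assms that by (intro mult_mono) auto
    then have "\<N> t ^ k \<le> 2 ^ (7 * (h * t)) * max_corner_free k (\<N> t)"
      unfolding \<N>_def by (intro max_corner_free_lower_bound[OF _ assms]) auto
    then have "real (\<N> t ^ k) \<le> real (2 ^ (7 * (h * t)) * max_corner_free k (\<N> t))"
      by (simp only: of_nat_le_iff)
    then show ?thesis using \<N>pos[of t] by (simp add: \<delta>_def field_simps mult.assoc)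
  qed
  define E where "E = (2::nat) ^ (7 * h + 1)"
  define T where "T = {t. \<delta> t \<le> real E * \<delta> (t + 1)}"
  have infT: "infinite T"
    using infinite_slow_decay[of \<delta> "7 * h"] \<delta>1 \<delta>low by (simp add: T_def E_def)
  define K where "K = 2 ^ (k + 1) * E"
  \<comment> \<open>The first summand comes from the iterated containers, the second from the factor
    \<open>2 ^ (2 * m)\<close> with \<open>m = K * mx\<close>.\<close>
  define C where "C = 4 * (real k)\<^sup>2 / c + 2 * real K"
  have K0: "K \<ge> 1" by (simp add: K_def E_def)
  have "C > 0" using K0 c by (simp add: C_def add_nonneg_pos)
  obtain u1 where u1: "\<And>u. u \<ge> u1 \<Longrightarrow>
      real ((k + 1)\<^sup>2) * (8 * 4 ^ k * 2 ^ (h\<^sup>2)) * real u ^ (4 + 2 * k) \<le> 2 ^ u"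
    using power_le_exp2[of "real ((k + 1)\<^sup>2) * (8 * 4 ^ k * 2 ^ (h\<^sup>2))" "4 + 2 * k"] by blast
  obtain u2 :: nat where u2: "2 / c \<le> real u2" using real_arch_simple by blast
  \<comment> \<open>\<open>u1\<close> serves the density condition, \<open>u2\<close> the condition
    \<open>2 * \<tau> \<le> c\<close>, and 16 the estimate
    \<open>16 * u \<le> u\<^sup>2\<close>.\<close>
  define t1 where "t1 = max u1 (max u2 16)"
  have good: "real (card {A. corner_free k (\<N> (t + 1)) A})
      \<le> 2 powr (C * real (max_corner_free k (\<N> (t + 1))))"
    if t: "t \<in> T" "t1 \<le> t" for t
  proof -
    define u where "u = h * (t + 1)"
    define N where "N = \<N> (t + 1)"
    define M where "M = \<N> t"
    define D where "D = (2::nat) ^ (h\<^sup>2 * (2 * t + 1))"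
    define l where "l = u\<^sup>2"
    define mx where "mx = max_corner_free k N"
    define m where "m = K * mx"
    \<comment> \<open>There are at least \<open>D / (2 * l)\<close> primes up to \<open>D\<close>,
      which is \<open>4 * l * d\<close>.\<close>
    define d where "d = real D / (8 * (real l)\<^sup>2)"
    \<comment> \<open>This makes \<open>l * \<tau> * N ^ k\<close> equal to \<open>mx\<close>: the
      division by \<open>l\<close> compensates for the logarithm of the base
      \<open>N ^ k + 1\<close> in the container count.\<close>
    define \<tau> where "\<tau> = \<delta> (t + 1) / real l"
    have "1 * (t + 1) \<le> u" unfolding u_def h_def using assms by (intro mult_right_mono) auto
    then have u: "u1 \<le> u" "u2 \<le> u" "16 \<le> u" using t(2) by (auto simp: t1_def)
    have N: "N = 2 ^ l" by (simp add: N_def \<N>_def l_def u_def)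
    have l: "l > 0" "u \<le> l" using u by (auto simp: l_def power2_eq_square)
    have DM: "D * M = N"
      unfolding D_def M_def N_def \<N>_def power_add[symmetric]
      by (rule arg_cong[where f = "(^) 2"]) (simp add: power2_eq_square algebra_simps)
    have Dh: "real D * 2 ^ (h\<^sup>2) = 2 ^ (8 * k * u)"
    proof -
      have "h\<^sup>2 * (2 * t + 1) + h\<^sup>2 = 2 * h * u"
        by (simp add: u_def power2_eq_square algebra_simps)
      also have "\<dots> = 8 * k * u" by (simp add: h_def)
      finally have "(2::real) ^ (h\<^sup>2 * (2 * t + 1) + h\<^sup>2) = 2 ^ (8 * k * u)" by simp
      then show ?thesis unfolding power_add D_def of_nat_power of_nat_numeral .
    qed
    have \<delta>u: "1 / 2 ^ (7 * u) \<le> \<delta> (t + 1)"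
      using \<delta>low[of "t + 1"] by (simp add: u_def field_simps mult.assoc)
    then have \<delta>pos: "\<delta> (t + 1) > 0" by (rule less_le_trans[rotated]) simp
    have Npos: "real (N ^ k) > 0" using \<N>pos[of "t + 1"] by (simp add: N_def)
    have mx: "real mx = \<delta> (t + 1) * real (N ^ k)" using Npos by (simp add: mx_def \<delta>_def N_def)
    then have "real mx > 0" using \<delta>pos Npos by simp
    then have m0: "m > 0" using K0 by (simp add: m_def)
    have \<tau>pos: "\<tau> > 0" using \<delta>pos l by (simp add: \<tau>_def)
    have \<tau>le: "\<tau> \<le> 1 / real l" using \<delta>1[of "t + 1"] l by (simp add: \<tau>_def divide_right_mono)
    have \<tau>1: "\<tau> \<le> 1" using \<tau>le l by (smt (verit) divide_le_eq_1 of_nat_0_less_iff of_nat_1 of_nat_le_iff Suc_leI One_nat_def)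
    have \<tau>c: "2 * \<tau> \<le> c"
    proof -
      have "2 / c \<le> real l" using u2 u(2) l(2) by linarith
      then have "2 / real l \<le> c" using c l by (simp add: field_simps)
      then show ?thesis using \<tau>le by simp
    qed
    have dens: "real ((k + 1)\<^sup>2) \<le> d * (\<tau> / 4) ^ k"
    proof -
      define x where "x = real u"
      have x: "x > 0" using u by (simp add: x_def)
      have "real ((k + 1)\<^sup>2) * (8 * 4 ^ k * 2 ^ (h\<^sup>2)) * x ^ (4 + 2 * k) \<le> 2 ^ u"
        unfolding x_def by (rule u1[OF u(1)])
      also have "\<dots> \<le> 2 ^ (k * u)" using assms by (intro power_increasing) auto
      finally have "real ((k + 1)\<^sup>2) \<le> 2 ^ (k * u) / ((8 * 4 ^ k * 2 ^ (h\<^sup>2)) * x ^ (4 + 2 * k))"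
        using x by (simp add: field_simps)
      also have "\<dots> = (2 ^ (8 * k * u) / 2 ^ (h\<^sup>2)) / (8 * (x\<^sup>2)\<^sup>2) * (1 / 2 ^ (7 * u) / x\<^sup>2 / 4) ^ k"
      proof -
        have "(2::real) ^ (8 * k * u) = 2 ^ (k * u) * (2 ^ (7 * u)) ^ k"
          by (simp add: power_mult[symmetric] power_add[symmetric])
        moreover have "x ^ (4 + 2 * k) = (x\<^sup>2)\<^sup>2 * (x\<^sup>2) ^ k"
          by (simp add: power_add power_mult)
        ultimately show ?thesis using x by (simp add: power_divide power_mult_distrib field_simps)
      qed
      also have "2 ^ (8 * k * u) / 2 ^ (h\<^sup>2) = real D" using Dh by (simp add: field_simps)
      also have "real D / (8 * (x\<^sup>2)\<^sup>2) = d" by (simp add: d_def l_def x_def)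
      also have "d * (1 / 2 ^ (7 * u) / x\<^sup>2 / 4) ^ k \<le> d * (\<tau> / 4) ^ k"
      proof (intro mult_left_mono power_mono divide_right_mono)
        have "1 / 2 ^ (7 * u) / x\<^sup>2 \<le> \<delta> (t + 1) / x\<^sup>2" using \<delta>u by (rule divide_right_mono) simp
        then show "1 / 2 ^ (7 * u) / x\<^sup>2 \<le> \<tau>" by (simp add: \<tau>_def l_def x_def)
      qed (use x in \<open>auto simp: d_def\<close>)
      finally show ?thesis .
    qed
    have d1: "d \<ge> 1"
    proof -
      have "d \<ge> 0" by (simp add: d_def)
      then have "d * (\<tau> / 4) ^ k \<le> d * 1" using \<tau>1 \<tau>pos by (intro mult_left_mono power_le_one) auto
      moreover have "1 \<le> real ((k + 1)\<^sup>2)" by simp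
      ultimately show ?thesis using dens by linarith
    qed
    have primes: "4 * real l * d \<le> real (card {p::nat. prime p \<and> p \<le> D})"
    proof -
      \<comment> \<open>With \<open>2 * n = D = 2 ^ w\<close> the prime bound reads
        \<open>2 ^ n \<le> 2 ^ (w * \<pi>)\<close>, so \<open>D / 2 \<le> w * \<pi>\<close>.\<close>
      define w where "w = h\<^sup>2 * (2 * t + 1)"
      define \<pi> where "\<pi> = card {p::nat. prime p \<and> p \<le> D}"
      have "w > 0" unfolding w_def h_def using assms by (intro mult_pos_pos) auto
      then have w: "w \<ge> 1" by simp
      have wl: "w \<le> l" by (simp add: w_def l_def u_def power2_eq_square algebra_simps)
      define n where "n = (2::nat) ^ (w - 1)"
      have n: "2 * n = D" using w unfolding n_def D_def w_def[symmetric] by (cases w) auto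
      have "2 ^ n \<le> (2 * n) ^ card {p::nat. prime p \<and> p \<le> 2 * n}"
        by (rule prime_count_lower_bound) (simp add: n_def)
      then have "(2::nat) ^ n \<le> 2 ^ (w * \<pi>)"
        unfolding n \<pi>_def[symmetric] power_mult by (simp add: D_def w_def)
      then have "n \<le> w * \<pi>" by simp
      also have "\<dots> \<le> l * \<pi>" using wl by simp
      finally have "real D \<le> 2 * real (l * \<pi>)" using n by linarith
      then have "real D / (2 * real l) \<le> real \<pi>" using l by (simp add: field_simps)
      moreover have "4 * real l * d = real D / (2 * real l)"
        using l by (simp add: d_def power2_eq_square field_simps)
      ultimately show ?thesis by (simp add: \<pi>_def)
    qed
    have big: "2 * (2 * N) ^ k * max_corner_free k M \<le> M ^ k * m"
    proof -
      have Mpos: "real (M ^ k) > 0" using \<N>pos[of t] by (simp add: M_def)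
      have "\<delta> t \<le> real E * \<delta> (t + 1)" using t(1) by (simp add: T_def)
      then have "real (max_corner_free k M) / real (M ^ k) \<le> real E * (real mx / real (N ^ k))"
        by (simp add: \<delta>_def M_def N_def mx_def)
      then have "real (N ^ k) * real (max_corner_free k M) \<le> real (M ^ k) * (real E * real mx)"
        using Mpos Npos by (simp add: field_simps del: of_nat_power)
      then have "real (N ^ k * max_corner_free k M) \<le> real (M ^ k * (E * mx))" by simp
      then have "N ^ k * max_corner_free k M \<le> M ^ k * (E * mx)" by (simp only: of_nat_le_iff)
      then have "2 ^ (k + 1) * (N ^ k * max_corner_free k M) \<le> 2 ^ (k + 1) * (M ^ k * (E * mx))"
        by (rule mult_left_mono) simp
      then show ?thesis by (simp add: m_def K_def power_mult_distrib mult_ac)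
    qed
    \<comment> \<open>The product is at least \<open>\<delta> (t + 1)\<close> squared times
      \<open>N ^ k / l\<close>. The losses are at most \<open>2 ^ (14 * u)\<close> from the
      densities and \<open>2 ^ (2 * u)\<close> from \<open>l\<close>, while
      \<open>N ^ k = 2 ^ (l * k)\<close> with \<open>l = u\<^sup>2 \<ge> 16 * u\<close>.\<close>
    have fp: "1 \<le> \<tau> * (2 * real m)"
    proof -
      have "u\<^sup>2 \<le> 2 ^ (2 * u)" using less_exp[of u] by (simp add: power_mult power_mono less_imp_le mult.commute)
      then have ul: "real l \<le> 2 ^ (2 * u)" unfolding l_def by (metis of_nat_le_iff of_nat_numeral of_nat_power)
      have "14 * u + 2 * u \<le> l * 1" using u(3) by (simp add: l_def power2_eq_square)
      also have "\<dots> \<le> l * k" using assms by (intro mult_left_mono) auto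
      finally have le: "(2::real) ^ (14 * u + 2 * u) \<le> 2 ^ (l * k)" by (intro power_increasing) auto
      have "(2 ^ (7 * u) * 2 ^ (7 * u)) * real l \<le> (2 ^ (7 * u) * 2 ^ (7 * u)) * 2 ^ (2 * u)"
        using ul by (rule mult_left_mono) simp
      also have "\<dots> = 2 ^ (14 * u + 2 * u)" by (simp add: power_add[symmetric])
      also note le
      also have "(2::real) ^ (l * k) = real (N ^ k)" by (simp add: N power_mult)
      finally have "(2 ^ (7 * u) * 2 ^ (7 * u)) * real l \<le> real (N ^ k)" .
      then have "1 \<le> (1 / 2 ^ (7 * u)) * (1 / 2 ^ (7 * u)) * real (N ^ k) / real l"
        using l by (simp add: field_simps)
      also have "\<dots> \<le> \<delta> (t + 1) * \<delta> (t + 1) * real (N ^ k) / real l"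
        using \<delta>u \<delta>pos by (intro divide_right_mono mult_right_mono mult_mono) auto
      also have "\<dots> = \<tau> * real mx" by (simp add: \<tau>_def mx)
      also have "\<dots> \<le> \<tau> * (2 * real m)"
      proof (intro mult_left_mono)
        have "1 * real mx \<le> (2 * real K) * real mx" using K0 by (intro mult_right_mono) auto
        then show "real mx \<le> 2 * real m" by (simp add: m_def)
      qed (use \<tau>pos in simp)
      finally show ?thesis .
    qed
    have "real (card {A. corner_free k N A})
        \<le> (real (N ^ k) + 1) powr (2 * \<tau> * real k / c * real (N ^ k)) * 2 ^ (2 * m)"
      by (rule count[of M l N D d m \<tau>])
        (use \<N>pos[of t] l N DM d1 primes m0 big \<tau>pos \<tau>c dens fp in \<open>auto simp: M_def\<close>)
    also have "\<dots> \<le> (2 powr (2 * real k * real l)) powr (2 * \<tau> * real k / c * real (N ^ k)) * 2 ^ (2 * m)"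
    proof (intro mult_right_mono powr_mono2)
      have "1 \<le> N ^ k" using \<N>pos[of "t + 1"] by (simp add: N_def)
      then have "real (N ^ k) + 1 \<le> 2 * real (N ^ k)" by linarith
      also have "\<dots> = 2 ^ (k * l + 1)" by (simp add: N power_mult[symmetric] mult.commute)
      also have "\<dots> \<le> 2 ^ (2 * k * l)"
      proof (rule power_increasing)
        have "1 \<le> k * l" using assms l by (simp add: Suc_le_eq)
        then show "k * l + 1 \<le> 2 * k * l" by simp
      qed simp
      also have "\<dots> = 2 powr (2 * real k * real l)" by (simp add: powr_realpow[symmetric])
      finally show "real (N ^ k) + 1 \<le> 2 powr (2 * real k * real l)" .
    qed (use \<tau>pos c in auto)
    also have "\<dots> = 2 powr ((2 * real k * real l) * (2 * \<tau> * real k / c * real (N ^ k))) * 2 powr (2 * real m)"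
      by (simp add: powr_powr powr_realpow[symmetric])
    also have "\<dots> = 2 powr ((2 * real k * real l) * (2 * \<tau> * real k / c * real (N ^ k)) + 2 * real m)"
      by (simp add: powr_add)
    also have "(2 * real k * real l) * (2 * \<tau> * real k / c * real (N ^ k)) + 2 * real m = C * real mx"
    proof -
      have "real l * \<tau> * real (N ^ k) = real mx" using l by (simp add: \<tau>_def mx)
      moreover have "(2 * real k * real l) * (2 * \<tau> * real k / c * real (N ^ k))
        = 4 * (real k)\<^sup>2 / c * (real l * \<tau> * real (N ^ k))" by (simp add: power2_eq_square)
      ultimately show ?thesis by (simp add: C_def m_def algebra_simps)
    qed
    finally show ?thesis by (simp add: N_def mx_def)
  qed
  \<comment> \<open>Infinitely many good indices \<open>t\<close> must yield infinitely many
    distinct values of \<open>N\<close>.\<close>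
  have "inj \<N>"
  proof (rule injI)
    fix x y assume "\<N> x = \<N> y"
    then have "(h * x)\<^sup>2 = (h * y)\<^sup>2" by (simp add: \<N>_def)
    then have "h * x = h * y" by simp
    then show "x = y" using assms by (simp add: h_def)
  qed
  then have inj: "inj_on (\<lambda>t. \<N> (t + 1)) (T - {..<t1})"
    by (auto intro!: inj_onI dest: injD)
  have "infinite ((\<lambda>t. \<N> (t + 1)) ` (T - {..<t1}))"
    using infT finite_imageD[OF _ inj] by (auto simp: Diff_infinite_finite)
  moreover have "(\<lambda>t. \<N> (t + 1)) ` (T - {..<t1}) \<subseteq> {N. N > 0 \<and>
      real (card {A. corner_free k N A}) \<le> 2 powr (C * real (max_corner_free k N))}"
    using good \<N>pos by (auto simp: not_less Suc_le_eq)
  ultimately show ?thesis using \<open>C > 0\<close> finite_subset by blast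
qed

end
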